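(* Let $d\in\mathbf{Z}\setminus\{0\}$, $g>0$, $0<\kappa<\infty$. Suppose $(f,S,m)$ is an admissible solution of $(GL)_{\kappa,g}$ and that $\mathcal{E}_{\kappa,g}''(f,S,m)[u,v,w]\ge0$ for all $(u,v,w)\in X\times X\times H$. Then $f'(r)>0$ for all $r>0$ and, if $m$ is not identically zero, $m'(r)<0$ for all $r>0$.
   Context: All functions are real-valued functions of $r$, and $\int u\,r\,dr=\int_0^\infty u(r)\,r\,dr$. $H$ is the space of radial functions in $H^1(\mathbf{R}^2)$, with $\|u\|_H^2=\int[(u')^2+u^2]\,r\,dr$; $X=\{u\in H:\int\frac{u^2}{r^2}\,r\,dr<\infty\}$. $(GL)_{\kappa,g}$ is the system $-f''-\frac1r f'+\frac{(d-S)^2}{r^2}f=\kappa^2(1-f^2-m^2)f$, $\;-S''+\frac1r S'=(d-S)f^2$, $\;-m''-\frac1r m'+\kappa^2gm=\kappa^2(1-f^2-m^2)m$, with energy $$\mathcal{E}_{\kappa,g}(f,S,m)=\frac12\int\Big\{(f')^2+\big[\tfrac{S'}{r}\big]^2+(m')^2+\kappa^2gm^2+\tfrac{(d-S)^2f^2}{r^2}+\tfrac{\kappa^2}{2}(1-f^2-m^2)^2\Big\}r\,dr.$$ $(f,S,m)$ is an admissible solution if: the system holds for all $r\in(0,\infty)$; $\mathcal{E}_{\kappa,g}(f,S,m)<\infty$; $f(r)\ge0$ and $m(r)\ge0$ for all $r\ge0$; $S(0)=0$ and $m'(0)=0$. The second variation is $\mathcal{E}_{\kappa,g}''(f,S,m)[u,v,w]=\frac{d^2}{dt^2}\big|_{t=0}\mathcal{E}_{\kappa,g}(f+tu,S+trv,m+tw)$,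 i.e. $$\int\Big\{(u')^2+(w')^2+\tfrac{(d-S)^2}{r^2}u^2+\kappa^2gw^2+(v')^2+\tfrac{v^2}{r^2}-4\tfrac{d-S}{r}fuv+f^2v^2-\kappa^2(1-f^2-m^2)(u^2+w^2)+2\kappa^2(fu+mw)^2\Big\}r\,dr.$$ *)

theory Defs
  imports "HOL-Analysis.Analysis"
begin

text \<open>
  Weak gradient of a real function on an open set \<open>\<Omega>\<close> of a Euclidean space. Test functions are
  \<open>\<phi> \<in> C\<^sup>1\<close> with compact support in \<open>\<Omega>\<close>; by mollification this gives the same notion as testing
  against \<open>C\<close>-infinity functions. On the real line the inner product is multiplication, so there
  \<open>G\<close> is the ordinary weak derivative.
\<close>

definition has_weak_gradient ::
    "'a set \<Rightarrow> ('a::euclidean_space \<Rightarrow> real) \<Rightarrow> ('a \<Rightarrow> 'a) \<Rightarrow> bool" where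
  "has_weak_gradient \<Omega> U G \<longleftrightarrow>
     (\<forall>K. compact K \<and> K \<subseteq> \<Omega> \<longrightarrow> set_integrable lebesgue K U \<and> set_integrable lebesgue K G) \<and>
     (\<forall>\<phi> D\<phi> K. compact K \<and> K \<subseteq> \<Omega> \<and> (\<forall>x. x \<notin> K \<longrightarrow> \<phi> x = 0) \<and>
        (\<forall>x. GDERIV \<phi> x :> D\<phi> x) \<and> continuous_on UNIV D\<phi> \<longrightarrow>
        (LINT x:\<Omega>|lebesgue. U x *\<^sub>R D\<phi> x) = - (LINT x:\<Omega>|lebesgue. \<phi> x *\<^sub>R G x))"

definition square_integrable :: "('a::euclidean_space \<Rightarrow> 'b::euclidean_space) \<Rightarrow> bool" where
  "square_integrable F \<longleftrightarrow>
     F \<in> borel_measurable lebesgue \<and> integrable lebesgue (\<lambda>x. (norm (F x))\<^sup>2)"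

definition sobolev_H1 :: "('a::euclidean_space \<Rightarrow> real) set" where
  "sobolev_H1 = {U. square_integrable U \<and>
     (\<exists>G. has_weak_gradient UNIV U G \<and> square_integrable G)}"

text \<open>
  A radial function is represented by its profile \<open>u\<close> on \<open>(0,\<infinity>)\<close>; the values of \<open>u\<close> at
  nonpositive arguments are irrelevant.
\<close>

definition H_space :: "(real \<Rightarrow> real) set" where
  "H_space = {u. (\<lambda>x::real^2. u (norm x)) \<in> sobolev_H1}"

definition X_space :: "(real \<Rightarrow> real) set" where
  "X_space = {u \<in> H_space. set_integrable lebesgue {0<..} (\<lambda>r. (u r)\<^sup>2 / r\<^sup>2 * r)}"

text \<open>
  The weak derivative on \<open>(0,\<infinity>)\<close> is determined only up to null sets; it is used below only under
  integrals. It exists for every \<open>u\<close> in \<^const>\<open>H_space\<close>.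
\<close>

definition weak_deriv :: "(real \<Rightarrow> real) \<Rightarrow> real \<Rightarrow> real" where
  "weak_deriv u = (SOME p. has_weak_gradient {0<..} u p)"

definition twice_differentiable_at :: "(real \<Rightarrow> real) \<Rightarrow> real \<Rightarrow> bool" where
  "twice_differentiable_at h r \<longleftrightarrow> h differentiable at r \<and> deriv h differentiable at r"

definition GL_system ::
    "real \<Rightarrow> real \<Rightarrow> int \<Rightarrow> (real \<Rightarrow> real) \<Rightarrow> (real \<Rightarrow> real) \<Rightarrow> (real \<Rightarrow> real) \<Rightarrow> bool" where
  "GL_system \<kappa> g d f S m \<longleftrightarrow> (\<forall>r>0.
     twice_differentiable_at f r \<and> twice_differentiable_at S r \<and> twice_differentiable_at m r \<and>
     - deriv (deriv f) r - 1 / r * deriv f r + (of_int d - S r)\<^sup>2 / r\<^sup>2 * f r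
       = \<kappa>\<^sup>2 * (1 - (f r)\<^sup>2 - (m r)\<^sup>2) * f r \<and>
     - deriv (deriv S) r + 1 / r * deriv S r = (of_int d - S r) * (f r)\<^sup>2 \<and>
     - deriv (deriv m) r - 1 / r * deriv m r + \<kappa>\<^sup>2 * g * m r
       = \<kappa>\<^sup>2 * (1 - (f r)\<^sup>2 - (m r)\<^sup>2) * m r)"

text \<open>
  The energy is evaluated only at classical solutions, so the derivatives are the classical ones.
\<close>

definition GL_energy ::
    "real \<Rightarrow> real \<Rightarrow> int \<Rightarrow> (real \<Rightarrow> real) \<Rightarrow> (real \<Rightarrow> real) \<Rightarrow> (real \<Rightarrow> real) \<Rightarrow> ennreal" where
  "GL_energy \<kappa> g d f S m = 1 / 2 * (\<integral>\<^sup>+ r\<in>{0<..}. ennreal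
     (((deriv f r)\<^sup>2 + (deriv S r / r)\<^sup>2 + (deriv m r)\<^sup>2 + \<kappa>\<^sup>2 * g * (m r)\<^sup>2
       + (of_int d - S r)\<^sup>2 * (f r)\<^sup>2 / r\<^sup>2
       + \<kappa>\<^sup>2 / 2 * (1 - (f r)\<^sup>2 - (m r)\<^sup>2)\<^sup>2) * r) \<partial>lebesgue)"

text \<open>
  The conditions at \<open>r = 0\<close> are one-sided: \<open>S(0) = 0\<close> is a boundary condition and so includes
  continuity of \<open>S\<close> at \<open>0\<close> from the right, and \<open>m'(0)\<close> is the right derivative.
\<close>

definition admissible_solution ::
    "real \<Rightarrow> real \<Rightarrow> int \<Rightarrow> (real \<Rightarrow> real) \<Rightarrow> (real \<Rightarrow> real) \<Rightarrow> (real \<Rightarrow> real) \<Rightarrow> bool" where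
  "admissible_solution \<kappa> g d f S m \<longleftrightarrow>
     GL_system \<kappa> g d f S m \<and>
     GL_energy \<kappa> g d f S m < \<infinity> \<and>
     (\<forall>r\<ge>0. f r \<ge> 0 \<and> m r \<ge> 0) \<and>
     S 0 = 0 \<and> continuous (at 0 within {0..}) S \<and>
     (m has_real_derivative 0) (at 0 within {0..})"

definition second_variation ::
    "real \<Rightarrow> real \<Rightarrow> int \<Rightarrow> (real \<Rightarrow> real) \<Rightarrow> (real \<Rightarrow> real) \<Rightarrow> (real \<Rightarrow> real) \<Rightarrow>
     (real \<Rightarrow> real) \<Rightarrow> (real \<Rightarrow> real) \<Rightarrow> (real \<Rightarrow> real) \<Rightarrow> real" where
  "second_variation \<kappa> g d f S m u v w = (LINT r:{0<..}|lebesgue.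
     ((weak_deriv u r)\<^sup>2 + (weak_deriv w r)\<^sup>2
      + (of_int d - S r)\<^sup>2 / r\<^sup>2 * (u r)\<^sup>2 + \<kappa>\<^sup>2 * g * (w r)\<^sup>2
      + (weak_deriv v r)\<^sup>2 + (v r)\<^sup>2 / r\<^sup>2
      - 4 * ((of_int d - S r) / r) * f r * u r * v r
      + (f r)\<^sup>2 * (v r)\<^sup>2
      - \<kappa>\<^sup>2 * (1 - (f r)\<^sup>2 - (m r)\<^sup>2) * ((u r)\<^sup>2 + (w r)\<^sup>2)
      + 2 * \<kappa>\<^sup>2 * (f r * u r + m r * w r)\<^sup>2) * r)"

end

theory Submission
  imports Defs
begin

text \<open>
  Put \<open>a = d - S\<close>, \<open>p = f'\<close> and \<open>q = -m'\<close>. Differentiating the system gives a cooperative pair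
  \<open>p'' + p'/r = (A\<^sub>1 + 1/r\<^sup>2) p - B q - h\<close> and \<open>q'' + q'/r = (A\<^sub>2 + 1/r\<^sup>2) q - B p\<close>, where \<open>A\<^sub>1\<close> and \<open>A\<^sub>2\<close>
  are the potentials of the second variation, \<open>B = 2\<kappa>\<^sup>2fm \<ge> 0\<close>, and \<open>h > 0\<close> because \<open>a S' \<ge> 0\<close>
  (finite energy) and \<open>a\<close> never vanishes. Testing the second variation with \<open>v = 0\<close> and the
  negative parts of \<open>p\<close> and \<open>q\<close>, multiplied by a cutoff \<open>\<eta>\<close>, therefore yields
  \<open>\<integral> \<eta>\<^sup>2 Q/r dr \<le> \<integral> \<eta>'\<^sup>2 Q r dr\<close> with \<open>Q = min(p,0)\<^sup>2 + min(q,0)\<^sup>2\<close>. As \<open>Q r\<close> is integrable,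
  \<open>\<eta>\<close> may tend to \<open>b = r/(1+r)\<close>, for which \<open>b' < b/r\<close>; hence \<open>Q = 0\<close>. No information on the behaviour at
  \<open>0\<close> beyond finite energy is needed. Finally, at a zero of \<open>p \<ge> 0\<close> the equation would give
  \<open>p'' < 0\<close>, and likewise for \<open>q\<close>.
\<close>

section \<open>Weak gradients\<close>

text \<open>The weight \<open>1/r\<close> in front of \<open>\<eta>^2 Q\<close> comes from
  differentiating the term \<open>f'/r\<close>: the equations for \<open>p\<close> and
  \<open>q\<close> contain \<open>1/r^2\<close>, the second variation does not. The choice \<eta>(r)
  = r would balance both sides exactly and give nothing; a strictly concave profile with slope 1 at
  0 makes the balance strict. Vanishing linearly at 0 keeps \<open>\<eta>^2 Q / r\<close> below
  \<open>r Q\<close>, so that the energy dominates both sides. The test functions must lie in X and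
  H, and their weak derivatives, picked by Hilbert choice, must be identified. Both are settled for
  C1 functions with compact support in (0,\<infinity>). Therefore the negative part is smoothed with
  a parameter \<delta>, and the cutoff is built from squares. \<delta> tends to 0 first, on a fixed
  compact interval; only then is the cutoff removed. The solution is assumed only twice
  differentiable. The differentiated equations are therefore stated for the fluxes
  \<open>r p'\<close> and \<open>r q'\<close>, which the system expresses through differentiable
  quantities.\<close>

lemma GDERIV_zero_off_support:
  fixes V :: "'a::euclidean_space \<Rightarrow> real"
  assumes "GDERIV V x :> D" and "closed K" and "x \<notin> K" and "\<And>y. y \<notin> K \<Longrightarrow> V y = 0"
  shows "D = 0"
proof -
  have "((\<lambda>_. 0) has_derivative (\<lambda>h. h \<bullet> D)) (at x)"
    using assms unfolding gderiv_def
    by - (rule has_derivative_transform_within_open[of V "\<lambda>h. h \<bullet> D" x UNIV "-K"], auto)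
  then have "(\<lambda>h. h \<bullet> D) = (\<lambda>_. 0)"
    by (rule has_derivative_unique[OF _ has_derivative_const])
  from fun_cong[OF this, of D] show ?thesis by simp
qed

lemma integrable_continuous_compact_support:
  fixes F :: "'a::euclidean_space \<Rightarrow> 'b::euclidean_space"
  assumes "continuous_on UNIV F" and "compact K" and "\<And>x. x \<notin> K \<Longrightarrow> F x = 0"
  shows "integrable lebesgue F"
proof -
  have "integrable lborel (\<lambda>x. indicator K x *\<^sub>R F x)"
    using assms by (intro borel_integrable_compact) (auto intro: continuous_on_subset)
  moreover have "(\<lambda>x. indicator K x *\<^sub>R F x) = F"
    using assms(3) by (auto simp: indicator_def)
  ultimately have "integrable lborel F" by simp
  moreover have "F \<in> borel_measurable lborel"
    using borel_measurable_continuous_onI[OF assms(1)] by simp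
  ultimately show ?thesis
    by (simp add: integrable_completion)
qed

text \<open>Translation invariance of Lebesgue measure makes every difference quotient of
  \<open>V\<close> integrate to 0. As \<open>V\<close> is Lipschitz with compact support, the
  quotients in a direction \<open>e\<close> converge dominatedly to the component
  \<open>DV x \<bullet> e\<close>.\<close>

lemma integral_gradient_eq_0:
  fixes V :: "'a::euclidean_space \<Rightarrow> real"
  assumes V: "\<And>x. GDERIV V x :> DV x" and cont: "continuous_on UNIV DV"
    and K: "compact K" and supp: "\<And>x. x \<notin> K \<Longrightarrow> V x = 0"
  shows "(LINT x|lebesgue. DV x) = 0"
proof -
  have contV: "continuous_on UNIV V"
    using V unfolding gderiv_def
    by (meson has_derivative_continuous continuous_at_imp_continuous_on)
  have DV0: "DV x = 0" if "x \<notin> K" for x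
    using GDERIV_zero_off_support[OF V compact_imp_closed[OF K] that] supp by blast
  have intDV: "integrable lebesgue DV"
    using integrable_continuous_compact_support[OF cont K] DV0 by blast
  have intV: "integrable lborel V"
    using integrable_continuous_compact_support[OF contV K] supp contV
    by (subst (asm) integrable_completion) (auto intro: borel_measurable_continuous_onI)
  obtain M where M: "\<And>x. norm (DV x) \<le> M"
  proof -
    have "bounded (DV ` K)"
      using K cont by (intro compact_imp_bounded compact_continuous_image) (auto intro: continuous_on_subset)
    then obtain M where "\<And>x. x \<in> K \<Longrightarrow> norm (DV x) \<le> M"
      by (auto simp: bounded_iff)
    then have "norm (DV x) \<le> max M 0" for x
      using DV0[of x] by (cases "x \<in> K") (auto simp: max.coboundedI1)
    then show ?thesis using that by blast
  qed
  have lip: "\<bar>V (x + h) - V x\<bar> \<le> M * norm h" for x h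
  proof -
    have "norm (V (x + h) - V x) \<le> M * norm (x + h - x)"
    proof (rule differentiable_bound[where S = UNIV])
      show "(V has_derivative (\<lambda>h. h \<bullet> DV y)) (at y within UNIV)" for y
        using V[of y] by (simp add: gderiv_def)
      show "onorm (\<lambda>h. h \<bullet> DV y) \<le> M" for y
        by (rule onorm_le) (metis Cauchy_Schwarz_ineq2 M mult.commute mult_right_mono norm_ge_zero
            order_trans real_norm_def)
    qed auto
    then show ?thesis by simp
  qed
  have "(LINT x|lebesgue. DV x \<bullet> e) = 0" for e
  proof -
    define t where "t n = 1 / real (Suc n)" for n
    define s where "s n x = (V (x + t n *\<^sub>R e) - V x) / t n" for n x
    \<comment> \<open>Contains the support of every difference quotient, because all steps satisfy
      \<open>t n \<le> 1\<close>.\<close>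
    define K' where "K' = {x + y | x y. x \<in> K \<and> y \<in> cball 0 (norm e)}"
    have tpos: "0 < t n" "t n \<le> 1" for n by (auto simp: t_def)
    have t0: "t \<longlonglongrightarrow> 0"
      unfolding t_def using lim_inverse_n'[THEN LIMSEQ_Suc] by (simp only: of_nat_Suc)
    have cK': "compact K'" unfolding K'_def by (intro compact_sums K compact_cball)
    have measV: "V \<in> borel_measurable borel"
      using contV by (rule borel_measurable_continuous_onI)
    have "(\<lambda>n. LINT x|lborel. s n x) \<longlonglongrightarrow> (LINT x|lborel. DV x \<bullet> e)"
    proof (rule integral_dominated_convergence[where w = "\<lambda>x. indicator K' x *\<^sub>R (M * norm e)"])
      show "(\<lambda>x. DV x \<bullet> e) \<in> borel_measurable lborel"
        using cont by (intro borel_measurable_inner) (auto intro: borel_measurable_continuous_onI)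
      show "s n \<in> borel_measurable lborel" for n
        unfolding s_def using tpos(1)[of n]
        by (auto intro!: borel_measurable_continuous_onI continuous_intros
            continuous_on_compose2[OF contV])
      show "integrable lborel (\<lambda>x. indicator K' x *\<^sub>R (M * norm e))"
        using cK' by (intro borel_integrable_compact) auto
      show "AE x in lborel. (\<lambda>n. s n x) \<longlonglongrightarrow> DV x \<bullet> e"
      proof (rule AE_I2)
        fix x
        have "((\<lambda>r. V (x + r *\<^sub>R e)) has_derivative (\<lambda>r. (r *\<^sub>R e) \<bullet> DV x)) (at 0)"
        proof (rule has_derivative_compose[of "\<lambda>r. x + r *\<^sub>R e" "\<lambda>r. r *\<^sub>R e" 0 UNIV V "\<lambda>h. h \<bullet> DV x"])
          show "((\<lambda>r. x + r *\<^sub>R e) has_derivative (\<lambda>r. r *\<^sub>R e)) (at 0)"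
            by (auto intro!: derivative_eq_intros)
          show "(V has_derivative (\<lambda>h. h \<bullet> DV x)) (at (x + 0 *\<^sub>R e))"
            using V[of x] by (simp add: gderiv_def)
        qed
        then have "((\<lambda>r. V (x + r *\<^sub>R e)) has_real_derivative (DV x \<bullet> e)) (at 0)"
          unfolding has_field_derivative_def
          by (rule has_derivative_eq_rhs) (simp add: inner_commute mult.commute fun_eq_iff)
        then have "((\<lambda>r. (V (x + r *\<^sub>R e) - V x) / r) \<longlongrightarrow> DV x \<bullet> e) (at 0)"
          unfolding DERIV_def by simp
        moreover have "filterlim t (at 0) sequentially"
          using t0 tpos(1) by (auto simp: filterlim_at less_le)
        ultimately show "(\<lambda>n. s n x) \<longlonglongrightarrow> DV x \<bullet> e"
          unfolding s_def by (rule filterlim_compose)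
      qed
      show "AE x in lborel. norm (s n x) \<le> indicator K' x *\<^sub>R (M * norm e)" for n
      proof (rule AE_I2)
        fix x
        show "norm (s n x) \<le> indicator K' x *\<^sub>R (M * norm e)"
        proof (cases "x \<in> K'")
          case True
          then show ?thesis
            using lip[of x "t n *\<^sub>R e"] tpos[of n] by (simp add: s_def field_simps)
        next
          case False
          have "x \<notin> K" using False by (force simp: K'_def)
          moreover have "x + t n *\<^sub>R e \<notin> K"
          proof
            assume "x + t n *\<^sub>R e \<in> K"
            moreover have "- (t n *\<^sub>R e) \<in> cball 0 (norm e)"
              using tpos[of n] by (simp add: mult_left_le_one_le)
            moreover have "x = (x + t n *\<^sub>R e) + - (t n *\<^sub>R e)" by simp
            ultimately show False using False unfolding K'_def by blast
          qed
          ultimately show ?thesis using False supp by (simp add: s_def)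
        qed
      qed
    qed
    moreover have "(LINT x|lborel. s n x) = 0" for n
    proof -
      have shift: "integrable lborel (\<lambda>x. V (x + t n *\<^sub>R e))"
        "(LINT x|lborel. V (x + t n *\<^sub>R e)) = (LINT x|lborel. V x)"
        using intV measV
          integrable_distr_eq[of "(+) (t n *\<^sub>R e)" lborel lborel V]
          integral_distr[of "(+) (t n *\<^sub>R e)" lborel borel V]
          integrable_distr_eq[of "(+) (t n *\<^sub>R e)" lborel borel V]
        by (simp_all add: lborel_distr_plus add.commute)
      show ?thesis
        unfolding s_def using shift intV by simp
    qed
    ultimately have "(LINT x|lborel. DV x \<bullet> e) = 0"
      by (simp add: LIMSEQ_const_iff)
    moreover have "(\<lambda>x. DV x \<bullet> e) \<in> borel_measurable lborel"
      using cont by (intro borel_measurable_inner) (auto intro: borel_measurable_continuous_onI)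
    ultimately show ?thesis by (simp add: integral_completion)
  qed
  then have "(LINT x|lebesgue. DV x) \<bullet> e = 0" for e
    using integral_inner_left[of e lebesgue DV] intDV by simp
  then show ?thesis using inner_eq_zero_iff by blast
qed

text \<open>The product \<open>U \<phi>\<close> inherits compact support from \<phi>, so its
  gradient integrates to 0; the product rule splits this into the integration by parts
  formula.\<close>

lemma has_weak_gradient_C1:
  fixes U :: "'a::euclidean_space \<Rightarrow> real"
  assumes U: "\<And>x. GDERIV U x :> G x" and cont: "continuous_on UNIV G"
  shows "has_weak_gradient \<Omega> U G"
  unfolding has_weak_gradient_def
proof (intro conjI allI impI)
  have contU: "continuous_on UNIV U"
    using U unfolding gderiv_def
    by (meson has_derivative_continuous continuous_at_imp_continuous_on)
  {
    fix K :: "'a set"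
    assume K: "compact K \<and> K \<subseteq> \<Omega>"
    have *: "set_integrable lebesgue K F" if "continuous_on UNIV F" for F :: "'a \<Rightarrow> 'b::euclidean_space"
    proof -
      have "integrable lborel (\<lambda>x. indicator K x *\<^sub>R F x)"
        using K that by (intro borel_integrable_compact) (auto intro: continuous_on_subset)
      moreover have "(\<lambda>x. indicator K x *\<^sub>R F x) \<in> borel_measurable lborel"
        using K that by (intro borel_measurable_scaleR borel_measurable_indicator)
          (auto intro: borel_measurable_continuous_onI borel_compact)
      ultimately show ?thesis
        unfolding set_integrable_def by (subst integrable_completion) auto
    qed
    show "set_integrable lebesgue K U" "set_integrable lebesgue K G"
      using * contU cont by blast+
  }
  fix \<phi> :: "'a \<Rightarrow> real" and D\<phi> :: "'a \<Rightarrow> 'a" and K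
  assume "compact K \<and> K \<subseteq> \<Omega> \<and> (\<forall>x. x \<notin> K \<longrightarrow> \<phi> x = 0) \<and>
    (\<forall>x. GDERIV \<phi> x :> D\<phi> x) \<and> continuous_on UNIV D\<phi>"
  then have K: "compact K" "K \<subseteq> \<Omega>" and \<phi>0: "\<And>x. x \<notin> K \<Longrightarrow> \<phi> x = 0"
    and \<phi>: "\<And>x. GDERIV \<phi> x :> D\<phi> x" and contD: "continuous_on UNIV D\<phi>" by auto
  have cont\<phi>: "continuous_on UNIV \<phi>"
    using \<phi> unfolding gderiv_def
    by (meson has_derivative_continuous continuous_at_imp_continuous_on)
  have D0: "D\<phi> x = 0" if "x \<notin> K" for x
    using GDERIV_zero_off_support[OF \<phi> compact_imp_closed[OF K(1)] that] \<phi>0 by blast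
  have int: "integrable lebesgue (\<lambda>x. U x *\<^sub>R D\<phi> x)" "integrable lebesgue (\<lambda>x. \<phi> x *\<^sub>R G x)"
    using contU cont\<phi> contD cont D0 \<phi>0
    by (intro integrable_continuous_compact_support[OF _ K(1)] continuous_intros; simp)+
  have "(LINT x|lebesgue. U x *\<^sub>R D\<phi> x + \<phi> x *\<^sub>R G x) = 0"
  proof (rule integral_gradient_eq_0[OF _ _ K(1)])
    show "GDERIV (\<lambda>x. U x * \<phi> x) x :> U x *\<^sub>R D\<phi> x + \<phi> x *\<^sub>R G x" for x
      by (rule GDERIV_mult[OF U \<phi>])
    show "continuous_on UNIV (\<lambda>x. U x *\<^sub>R D\<phi> x + \<phi> x *\<^sub>R G x)"
      using contU cont\<phi> contD cont by (intro continuous_intros)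
  qed (simp add: \<phi>0)
  then have "(LINT x|lebesgue. U x *\<^sub>R D\<phi> x) = - (LINT x|lebesgue. \<phi> x *\<^sub>R G x)"
    using int by (simp add: eq_neg_iff_add_eq_0)
  moreover have "indicator \<Omega> x *\<^sub>R (U x *\<^sub>R D\<phi> x) = U x *\<^sub>R D\<phi> x"
    "indicator \<Omega> x *\<^sub>R (\<phi> x *\<^sub>R G x) = \<phi> x *\<^sub>R G x" for x
    using D0[of x] \<phi>0[of x] K(2) by (auto simp: indicator_def)
  ultimately show "(LINT x:\<Omega>|lebesgue. U x *\<^sub>R D\<phi> x) = - (LINT x:\<Omega>|lebesgue. \<phi> x *\<^sub>R G x)"
    by (simp only: set_lebesgue_integral_def)
qed

text \<open>Squaring removes the kink of the positive part. Both the bump functions in the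
  uniqueness proof for weak derivatives and the final cutoff get their C1 regularity from
  this.\<close>

lemma has_real_derivative_pos_part_square:
  "((\<lambda>x. (max 0 x)\<^sup>2) has_real_derivative 2 * max 0 x) (at x)"
proof -
  consider "x > 0" | "x < 0" | "x = 0" by linarith
  then show ?thesis
  proof cases
    case 1
    have "((\<lambda>x. x\<^sup>2) has_real_derivative 2 * max 0 x) (at x)"
      using 1 by (auto intro!: derivative_eq_intros)
    then show ?thesis
      by (rule DERIV_cong_ev[OF refl _ refl, THEN iffD1, rotated])
        (use 1 in \<open>auto intro!: eventually_mono[OF eventually_nhds_in_open[of "{0<..}" x]]\<close>)
  next
    case 2
    have "((\<lambda>_. 0) has_real_derivative 2 * max 0 x) (at x)"
      using 2 by (auto intro!: derivative_eq_intros)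
    then show ?thesis
      by (rule DERIV_cong_ev[OF refl _ refl, THEN iffD1, rotated])
        (use 2 in \<open>auto intro!: eventually_mono[OF eventually_nhds_in_open[of "{..<0}" x]]\<close>)
  next
    case 3
    have "((\<lambda>h::real. (max 0 h)\<^sup>2 / h) \<longlongrightarrow> 0) (at 0)"
    proof (rule Lim_null_comparison)
      show "\<forall>\<^sub>F h::real in at 0. norm ((max 0 h)\<^sup>2 / h) \<le> \<bar>h\<bar>"
        by (rule eventually_at_topological[THEN iffD2])
          (auto simp: max_def power2_eq_square intro!: exI[of _ UNIV])
      show "((\<lambda>h::real. \<bar>h\<bar>) \<longlongrightarrow> 0) (at 0)"
        by (rule tendsto_eq_intros refl | simp)+
    qed
    then show ?thesis using 3 by (simp add: DERIV_def)
  qed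
qed

text \<open>Passes from the Lebesgue integrals over \<open>{0<..}\<close> in the definitions to
  gauge integrals over compact intervals, where continuity gives integrability and the fundamental
  theorem of calculus applies.\<close>

lemma set_lebesgue_integral_interval_support:
  fixes F :: "real \<Rightarrow> real"
  assumes cont: "continuous_on {a..b} F" and sub: "{a..b} \<subseteq> S"
    and supp: "\<And>x. x \<in> S \<Longrightarrow> x \<notin> {a..b} \<Longrightarrow> F x = 0"
  shows "set_integrable lebesgue S F" "(LINT x:S|lebesgue. F x) = integral {a..b} F"
proof -
  have eq: "(\<lambda>x. indicator S x *\<^sub>R F x) = (\<lambda>x. indicator {a..b} x *\<^sub>R F x)"
  proof
    fix x
    show "indicator S x *\<^sub>R F x = indicator {a..b} x *\<^sub>R F x"
      using sub supp[of x] by (cases "x \<in> S"; cases "x \<in> {a..b}") (auto simp del: atLeastAtMost_iff)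
  qed
  have int: "set_integrable lebesgue {a..b} F"
    using absolutely_integrable_continuous_real[OF cont] .
  then show "set_integrable lebesgue S F"
    unfolding set_integrable_def eq .
  show "(LINT x:S|lebesgue. F x) = integral {a..b} F"
    using set_lebesgue_integral_eq_integral(2)[OF int]
    unfolding set_lebesgue_integral_def eq .
qed

text \<open>
  Testing with \<open>C\<^sup>1\<close> approximations of the indicator of an interval shows that \<open>p - q\<close> has
  integral \<open>0\<close> over every interval; Lebesgue differentiation then gives the claim.
\<close>

lemma weak_derivative_unique:
  fixes u p q :: "real \<Rightarrow> real"
  assumes p: "has_weak_gradient {0<..} u p" and q: "has_weak_gradient {0<..} u q"
  shows "AE r in lebesgue. r > 0 \<longrightarrow> p r = q r"
proof -
  have integrable: "set_integrable lebesgue {a..b} (\<lambda>r. p r - q r)" if "0 < a" for a b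
  proof -
    have "compact {a..b} \<and> {a..b} \<subseteq> {0<..}" using that by auto
    then have "set_integrable lebesgue {a..b} p" "set_integrable lebesgue {a..b} q"
      using p q unfolding has_weak_gradient_def by blast+
    then show ?thesis by (rule set_integral_diff)
  qed
  have zero: "(LINT r:{a..b}|lebesgue. p r - q r) = 0" if ab: "0 < a" "a < b" for a b
  proof -
    define z where "z r = (max 0 ((r - a) * (b - r)))\<^sup>2" for r :: real
    define z' where "z' r = 2 * max 0 ((r - a) * (b - r)) * (a + b - 2 * r)" for r :: real
    define e where "e k = 1 / real (Suc k)" for k
    \<comment> \<open>As \<open>z\<close> is positive exactly on the open interval, the quotient
      \<open>z / (z + e)\<close> stays in [0,1], is C1, and tends to the indicator of that interval
      as \<open>e\<close> tends to 0.\<close>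
    define \<phi> where "\<phi> k r = z r / (z r + e k)" for k r
    define \<phi>' where "\<phi>' k r = e k * z' r / (z r + e k)\<^sup>2" for k r
    have e: "e k > 0" for k by (simp add: e_def)
    have z0: "z r \<ge> 0" for r by (simp add: z_def)
    have ne: "z r + e k \<noteq> 0" for r k using e[of k] z0[of r] by linarith
    have zder: "(z has_real_derivative z' r) (at r)" for r
      unfolding z_def z'_def
      by (rule DERIV_cong, rule DERIV_chain2[OF has_real_derivative_pos_part_square])
        (auto intro!: derivative_eq_intros)
    have \<phi>der: "(\<phi> k has_real_derivative \<phi>' k r) (at r)" for k r
      unfolding \<phi>_def[abs_def] \<phi>'_def using ne[of r k] zder[of r]
      by (auto intro!: derivative_eq_intros simp: power2_eq_square algebra_simps)
    have contz: "continuous_on UNIV z" "continuous_on UNIV z'"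
      unfolding z_def[abs_def] z'_def[abs_def] by (intro continuous_intros)+
    have cont\<phi>': "continuous_on UNIV (\<phi>' k)" for k
      unfolding \<phi>'_def[abs_def] using contz ne by (intro continuous_intros) auto
    have cont\<phi>: "continuous_on UNIV (\<phi> k)" for k
      unfolding \<phi>_def[abs_def] using contz ne by (intro continuous_intros) auto
    have z_out: "z r = 0" if "r \<notin> {a<..<b}" for r
    proof -
      have "(r - a) * (b - r) \<le> 0" using that ab by (auto simp: mult_le_0_iff)
      then show ?thesis by (simp add: z_def)
    qed
    have z_in: "z r > 0" if "r \<in> {a<..<b}" for r
      using that by (auto simp: z_def)
    have \<phi>_out: "\<phi> k r = 0" if "r \<notin> {a<..<b}" for k r
      using z_out[OF that] by (simp add: \<phi>_def)
    have \<phi>_le: "\<bar>\<phi> k r\<bar> \<le> 1" for k r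
      using e[of k] z0[of r] by (simp add: \<phi>_def)
    define D where "D r = indicator {a..b} r *\<^sub>R (p r - q r)" for r
    have intD: "integrable lebesgue D"
      using integrable[OF ab(1)] by (simp add: D_def[abs_def] set_integrable_def)
    have \<phi>D: "(LINT r|lebesgue. \<phi> k r * D r) = 0" for k
    proof -
      have int: "integrable lebesgue (\<lambda>r. indicator {0<..} r *\<^sub>R (\<phi> k r *\<^sub>R s r))"
        if "set_integrable lebesgue {a..b} s" for s :: "real \<Rightarrow> real"
      proof (rule Bochner_Integration.integrable_bound)
        show "integrable lebesgue (\<lambda>r. indicator {a..b} r *\<^sub>R s r)"
          using that by (simp add: set_integrable_def)
        have eq: "(\<lambda>r. indicator {0<..} r *\<^sub>R (\<phi> k r *\<^sub>R s r)) = (\<lambda>r. \<phi> k r *\<^sub>R (indicator {a..b} r *\<^sub>R s r))"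
        proof
          fix r
          show "indicator {0<..} r *\<^sub>R (\<phi> k r *\<^sub>R s r) = \<phi> k r *\<^sub>R (indicator {a..b} r *\<^sub>R s r)"
            using \<phi>_out[of r k] ab by (cases "r \<in> {a<..<b}") auto
        qed
        show "(\<lambda>r. indicator {0<..} r *\<^sub>R (\<phi> k r *\<^sub>R s r)) \<in> borel_measurable lebesgue"
          unfolding eq using borel_measurable_continuous_onI[OF cont\<phi>[of k]]
            borel_measurable_integrable[OF that[unfolded set_integrable_def]]
          by - (rule borel_measurable_scaleR, simp_all add: measurable_completion)
        show "AE r in lebesgue. norm (indicator {0<..} r *\<^sub>R (\<phi> k r *\<^sub>R s r))
            \<le> norm (indicator {a..b} r *\<^sub>R s r)"
        proof (rule AE_I2)
          fix r
          have "\<bar>\<phi> k r\<bar> * norm (indicator {a..b} r *\<^sub>R s r) \<le> 1 * norm (indicator {a..b} r *\<^sub>R s r)"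
            by (intro mult_right_mono \<phi>_le) auto
          then show "norm (indicator {0<..} r *\<^sub>R (\<phi> k r *\<^sub>R s r)) \<le> norm (indicator {a..b} r *\<^sub>R s r)"
            unfolding fun_cong[OF eq, of r] norm_scaleR by simp
        qed
      qed
      have K: "compact {a..b} \<and> {a..b} \<subseteq> {0<..} \<and> (\<forall>r. r \<notin> {a..b} \<longrightarrow> \<phi> k r = 0) \<and>
          (\<forall>r. GDERIV (\<phi> k) r :> \<phi>' k r) \<and> continuous_on UNIV (\<phi>' k)"
        using ab \<phi>_out[of _ k] \<phi>der[of k] cont\<phi>'[of k] by auto
      have eq: "(LINT r:{0<..}|lebesgue. \<phi> k r *\<^sub>R p r) = (LINT r:{0<..}|lebesgue. \<phi> k r *\<^sub>R q r)"
        using p[unfolded has_weak_gradient_def, THEN conjunct2, rule_format, OF K]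
          q[unfolded has_weak_gradient_def, THEN conjunct2, rule_format, OF K] by linarith
      have cpt: "compact {a..b} \<and> {a..b} \<subseteq> {0<..}" using ab by auto
      have pq: "set_integrable lebesgue {a..b} p" "set_integrable lebesgue {a..b} q"
        using p q cpt unfolding has_weak_gradient_def by blast+
      have "(LINT r|lebesgue. indicator {0<..} r *\<^sub>R (\<phi> k r *\<^sub>R p r)
          - indicator {0<..} r *\<^sub>R (\<phi> k r *\<^sub>R q r)) = 0"
        using eq int[OF pq(1)] int[OF pq(2)]
        by (simp only: Bochner_Integration.integral_diff set_lebesgue_integral_def)
      moreover have "indicator {0<..} r *\<^sub>R (\<phi> k r *\<^sub>R p r) - indicator {0<..} r *\<^sub>R (\<phi> k r *\<^sub>R q r)
          = \<phi> k r * D r" for r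
        using \<phi>_out[of r k] ab by (cases "r \<in> {a<..<b}") (auto simp: D_def algebra_simps)
      ultimately show ?thesis by simp
    qed
    have "(\<lambda>k. LINT r|lebesgue. \<phi> k r * D r) \<longlonglongrightarrow> (LINT r|lebesgue. indicator {a<..<b} r * D r)"
    proof (rule integral_dominated_convergence[where w = "\<lambda>r. \<bar>D r\<bar>"])
      show "(\<lambda>r. indicator {a<..<b} r * D r) \<in> borel_measurable lebesgue"
        using intD by (intro borel_measurable_times borel_measurable_indicator) auto
      show "(\<lambda>r. \<phi> k r * D r) \<in> borel_measurable lebesgue" for k
        using intD borel_measurable_continuous_onI[OF cont\<phi>[of k]]
        by (intro borel_measurable_times) (auto intro: measurable_completion)
      show "integrable lebesgue (\<lambda>r. \<bar>D r\<bar>)" using intD by (rule integrable_abs)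
      show "AE r in lebesgue. (\<lambda>k. \<phi> k r * D r) \<longlonglongrightarrow> indicator {a<..<b} r * D r"
      proof (rule AE_I2, rule tendsto_mult_right)
        fix r
        show "(\<lambda>k. \<phi> k r) \<longlonglongrightarrow> indicator {a<..<b} r"
        proof (cases "r \<in> {a<..<b}")
          case True
          have "e \<longlonglongrightarrow> 0"
            unfolding e_def[abs_def] using lim_inverse_n'[THEN LIMSEQ_Suc] by (simp only: of_nat_Suc)
          then have "(\<lambda>k. \<phi> k r) \<longlonglongrightarrow> z r / (z r + 0)"
            unfolding \<phi>_def using z_in[OF True] by (intro tendsto_intros) auto
          then show ?thesis using True z_in[OF True] by simp
        next
          case False
          then show ?thesis using \<phi>_out by simp
        qed
      qed
      show "AE r in lebesgue. norm (\<phi> k r * D r) \<le> \<bar>D r\<bar>" for k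
        using \<phi>_le[of k] by (auto intro!: AE_I2 simp: abs_mult mult_left_le_one_le)
    qed
    then have "(LINT r|lebesgue. indicator {a<..<b} r * D r) = 0"
      by (simp add: \<phi>D LIMSEQ_const_iff)
    moreover have "(LINT r|lebesgue. indicator {a<..<b} r * D r) = (LINT r|lebesgue. D r)"
    proof (rule integral_cong_AE)
      show "(\<lambda>r. indicator {a<..<b} r * D r) \<in> borel_measurable lebesgue"
        using intD by (intro borel_measurable_times borel_measurable_indicator) auto
      show "D \<in> borel_measurable lebesgue" using intD by auto
      have "AE r in lborel. r \<noteq> a" "AE r in lborel. r \<noteq> b" by (rule AE_lborel_singleton)+
      then have "AE r in lborel. indicator {a<..<b} r * D r = D r"
        by eventually_elim (auto simp: D_def indicator_def)
      then show "AE r in lebesgue. indicator {a<..<b} r * D r = D r"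
        by (rule AE_completion)
    qed
    ultimately show ?thesis by (simp add: D_def[abs_def] set_lebesgue_integral_def)
  qed
  have ae: "AE r in lebesgue. r \<in> {c<..<b} \<longrightarrow> p r = q r" if "0 < c" for c b
  proof -
    \<comment> \<open>Extension by 0, since the differentiation theorem asks for integrability on
      every bounded interval of the line.\<close>
    define g where "g r = (if r \<in> {c..b} then p r - q r else 0)" for r
    have intg: "g integrable_on cbox s t" for s t
    proof -
      have "g integrable_on UNIV"
        unfolding g_def[abs_def] integrable_restrict_UNIV
        using set_lebesgue_integral_eq_integral(1)[OF integrable[OF that]] by simp
      then show ?thesis
        by (rule integrable_on_subcbox) auto
    qed
    obtain N where N: "negligible N"
      "\<And>x e. x \<notin> N \<Longrightarrow> 0 < e \<Longrightarrow> \<exists>d>0. \<forall>h. 0 < h \<and> h < d \<longrightarrow>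
         norm (integral (cbox x (x + h *\<^sub>R One)) g /\<^sub>R h ^ DIM(real) - g x) < e"
      using integrable_ccontinuous_explicit[OF intg] by blast
    have "p x = q x" if x: "x \<notin> N" "x \<in> {c<..<b}" for x
    proof (rule ccontr)
      assume neq: "p x \<noteq> q x"
      have gx: "g x = p x - q x" using x by (simp add: g_def)
      obtain d where d: "d > 0" "\<And>h. 0 < h \<Longrightarrow> h < d \<Longrightarrow>
          norm (integral (cbox x (x + h *\<^sub>R One)) g /\<^sub>R h ^ DIM(real) - g x) < \<bar>p x - q x\<bar>"
        using N(2)[OF x(1), of "\<bar>p x - q x\<bar>"] neq by auto
      \<comment> \<open>Less than \<open>b - x\<close>, so that the interval from \<open>x\<close>
        to \<open>x + h\<close> stays where \<open>g\<close> is \<open>p - q\<close> and its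
        integral is known to vanish.\<close>
      define h where "h = min d (b - x) / 2"
      have h: "0 < h" "h < d" "x + h < b" using d(1) x by (auto simp: h_def min_def field_simps)
      have "integral (cbox x (x + h *\<^sub>R One)) g = integral {x..x + h} (\<lambda>r. p r - q r)"
        using x h by (auto simp: g_def intro!: integral_cong)
      also have "\<dots> = (LINT r:{x..x + h}|lebesgue. p r - q r)"
        using x \<open>0 < c\<close> by (intro set_lebesgue_integral_eq_integral(2)[symmetric] integrable) auto
      also have "\<dots> = 0" using x \<open>0 < c\<close> h by (intro zero) auto
      finally show False using d(2)[OF h(1,2)] gx by simp
    qed
    then have "{x. \<not> (x \<in> {c<..<b} \<longrightarrow> p x = q x)} \<subseteq> N" by auto
    then show ?thesis
      using N(1) by (auto simp: negligible_iff_null_sets intro: AE_I' [of N])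
  qed
  have "AE r in lebesgue. \<forall>n::nat. r \<in> {1 / real (Suc n)<..<real n} \<longrightarrow> p r = q r"
    unfolding AE_all_countable using ae by auto
  then show ?thesis
  proof eventually_elim
    case (elim r)
    show ?case
    proof
      assume r: "r > 0"
      obtain i where i: "1 / real (Suc i) < r"
        using r reals_Archimedean[of r] by (auto simp: inverse_eq_divide)
      obtain j where j: "r < real j" using reals_Archimedean2 by blast
      have "1 / real (Suc (max i j)) \<le> 1 / real (Suc i)"
        by (intro divide_left_mono) auto
      then have "1 / real (Suc (max i j)) < r" using i by linarith
      moreover have "r < real (max i j)" using j by auto
      ultimately show "p r = q r" using elim by auto
    qed
  qed
qed

section \<open>Radial C1 test functions and the second variation at them\<close>

lemma continuous_on_real_derivative:
  assumes "\<And>r. r \<in> A \<Longrightarrow> (u has_real_derivative u' r) (at r)"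
  shows "continuous_on A u"
  using assms by (meson DERIV_isCont continuous_at_imp_continuous_on)

lemma derivative_zero_off_interval:
  fixes u :: "real \<Rightarrow> real"
  assumes "(u has_real_derivative D) (at r)" and "\<And>r. r \<notin> {a..b} \<Longrightarrow> u r = 0" and "r \<notin> {a..b}"
  shows "D = 0"
  using GDERIV_zero_off_support[of u r D "{a..b}"] assms by simp

text \<open>The candidate gradient \<open>u'(|x|) x/|x|\<close> could be discontinuous only at the
  origin, and there it vanishes identically on a ball of radius \<open>a\<close>. The planar
  function is thus C1 with compact support.\<close>

lemma radial_C1_in_H_space:
  fixes u :: "real \<Rightarrow> real"
  assumes u: "\<And>r. (u has_real_derivative u' r) (at r)" and cont: "continuous_on UNIV u'"
    and supp: "\<And>r. r \<notin> {a..b} \<Longrightarrow> u r = 0" and "0 < a"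
  shows "u \<in> H_space"
proof -
  define U where "U x = u (norm x)" for x :: "real^2"
  define G where "G x = u' (norm x) *\<^sub>R sgn x" for x :: "real^2"
  have contu: "continuous_on UNIV u"
    using continuous_on_real_derivative u by blast
  have u'0: "u' r = 0" if "r \<notin> {a..b}" for r
    using derivative_zero_off_interval[OF u supp that] .
  have U0: "U x = 0" "G x = 0" if "norm x < a" for x
    using that supp u'0 by (auto simp: U_def G_def)
  have GD: "GDERIV U x :> G x" for x
  proof (cases "x = 0")
    case True
    have "((\<lambda>_. 0) has_derivative (\<lambda>h. h \<bullet> G x)) (at x)"
      using True by (simp add: G_def)
    then have "(U has_derivative (\<lambda>h. h \<bullet> G x)) (at x)"
      by (rule has_derivative_transform_within_open[of "\<lambda>_. 0" "\<lambda>h. h \<bullet> G x" x UNIV "ball 0 a"])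
        (use True \<open>0 < a\<close> U0 in auto)
    then show ?thesis by (simp add: gderiv_def)
  next
    case False
    then show ?thesis
      unfolding U_def[abs_def] G_def by (intro GDERIV_DERIV_compose GDERIV_norm u)
  qed
  have contG: "continuous_on UNIV G"
  proof (rule continuous_at_imp_continuous_on, rule ballI)
    fix x :: "real^2"
    show "isCont G x"
    proof (cases "x = 0")
      case True
      have "isCont (\<lambda>_. 0 :: real^2) x \<longleftrightarrow> isCont G x"
        by (rule isCont_cong)
          (use True \<open>0 < a\<close> U0 in \<open>auto intro!: eventually_mono[OF eventually_nhds_in_open[of "ball 0 a"]]\<close>)
      then show ?thesis by simp
    next
      case False
      have "isCont (\<lambda>x. u' (norm x)) x"
        by (rule isCont_o2[OF continuous_norm[OF continuous_ident]])
          (use cont continuous_on_eq_continuous_at[of UNIV u'] in auto)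
      then show ?thesis unfolding G_def[abs_def] sgn_div_norm
        using False by (intro continuous_intros) auto
    qed
  qed
  have contU: "continuous_on UNIV U"
    unfolding U_def[abs_def] by (intro continuous_on_compose2[OF contu] continuous_intros) auto
  have sq: "square_integrable F" if F: "continuous_on UNIV F" and "\<And>x. x \<notin> cball 0 b \<Longrightarrow> F x = 0"
    for F :: "real^2 \<Rightarrow> 'c::euclidean_space"
    unfolding square_integrable_def
  proof
    show "F \<in> borel_measurable lebesgue"
      using borel_measurable_continuous_onI[OF F] by (simp add: measurable_completion)
    show "integrable lebesgue (\<lambda>x. (norm (F x))\<^sup>2)"
      using that by (intro integrable_continuous_compact_support[of _ "cball 0 b"] continuous_intros) auto
  qed
  have "square_integrable U" "square_integrable G"
    using supp u'0 by (auto intro!: sq contU contG simp: U_def G_def)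
  then have "U \<in> sobolev_H1"
    unfolding sobolev_H1_def using has_weak_gradient_C1[OF GD contG] by blast
  then show ?thesis by (simp add: H_space_def U_def[abs_def])
qed

lemma radial_C1_in_X_space:
  fixes u :: "real \<Rightarrow> real"
  assumes u: "\<And>r. (u has_real_derivative u' r) (at r)" and cont: "continuous_on UNIV u'"
    and supp: "\<And>r. r \<notin> {a..b} \<Longrightarrow> u r = 0" and "0 < a"
  shows "u \<in> X_space"
proof -
  have "continuous_on UNIV u"
    using continuous_on_real_derivative u by blast
  then have contu: "continuous_on {max a 0..b} u"
    by (rule continuous_on_subset) auto
  have "set_integrable lebesgue {0<..} (\<lambda>r. (u r)\<^sup>2 / r\<^sup>2 * r)"
  proof (rule set_lebesgue_integral_interval_support(1))
    show "continuous_on {a..b} (\<lambda>r. (u r)\<^sup>2 / r\<^sup>2 * r)"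
      using contu \<open>0 < a\<close> by (intro continuous_intros) (auto simp: max_def)
  qed (use \<open>0 < a\<close> supp in auto)
  then show ?thesis
    using radial_C1_in_H_space[OF assms] by (simp add: X_space_def)
qed

text \<open>The classical derivative shows that the choice defining \<open>weak_deriv\<close> has a
  candidate; uniqueness then identifies whatever was chosen, up to a null set.\<close>

lemma weak_deriv_C1:
  fixes u :: "real \<Rightarrow> real"
  assumes "\<And>r. (u has_real_derivative u' r) (at r)" and "continuous_on UNIV u'"
  shows "AE r in lebesgue. r > 0 \<longrightarrow> weak_deriv u r = u' r"
proof -
  have *: "has_weak_gradient {0<..} u u'"
    using assms by (intro has_weak_gradient_C1) auto
  then have "has_weak_gradient {0<..} u (weak_deriv u)"
    unfolding weak_deriv_def by (rule someI[of "has_weak_gradient {0<..} u"])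
  then show ?thesis using * by (rule weak_derivative_unique)
qed

lemma second_variation_C1:
  fixes u w f S m :: "real \<Rightarrow> real"
  assumes u: "\<And>r. (u has_real_derivative u' r) (at r)" "continuous_on UNIV u'"
    "\<And>r. r \<notin> {a..b} \<Longrightarrow> u r = 0"
    and w: "\<And>r. (w has_real_derivative w' r) (at r)" "continuous_on UNIV w'"
    "\<And>r. r \<notin> {a..b} \<Longrightarrow> w r = 0"
    and "0 < a"
    and cont: "continuous_on {0<..} f" "continuous_on {0<..} S" "continuous_on {0<..} m"
  shows "second_variation \<kappa> g d f S m u (\<lambda>_. 0) w = integral {a..b} (\<lambda>r.
      ((u' r)\<^sup>2 + (w' r)\<^sup>2 + (of_int d - S r)\<^sup>2 / r\<^sup>2 * (u r)\<^sup>2 + \<kappa>\<^sup>2 * g * (w r)\<^sup>2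
       - \<kappa>\<^sup>2 * (1 - (f r)\<^sup>2 - (m r)\<^sup>2) * ((u r)\<^sup>2 + (w r)\<^sup>2)
       + 2 * \<kappa>\<^sup>2 * (f r * u r + m r * w r)\<^sup>2) * r)"
    (is "_ = integral _ ?E")
proof -
  let ?F = "\<lambda>r. ((weak_deriv u r)\<^sup>2 + (weak_deriv w r)\<^sup>2
      + (of_int d - S r)\<^sup>2 / r\<^sup>2 * (u r)\<^sup>2 + \<kappa>\<^sup>2 * g * (w r)\<^sup>2
      + (weak_deriv (\<lambda>_. 0) r)\<^sup>2 + (0::real)\<^sup>2 / r\<^sup>2
      - 4 * ((of_int d - S r) / r) * f r * u r * 0
      + (f r)\<^sup>2 * 0\<^sup>2
      - \<kappa>\<^sup>2 * (1 - (f r)\<^sup>2 - (m r)\<^sup>2) * ((u r)\<^sup>2 + (w r)\<^sup>2)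
      + 2 * \<kappa>\<^sup>2 * (f r * u r + m r * w r)\<^sup>2) * r"
  have sub: "{a..b} \<subseteq> {0<..}" using \<open>0 < a\<close> by auto
  have contuw: "continuous_on {a..b} u" "continuous_on {a..b} w"
    "continuous_on {a..b} u'" "continuous_on {a..b} w'"
    using continuous_on_real_derivative u(1) apply blast
    using continuous_on_real_derivative w(1) apply blast
    using u(2) w(2) by (auto intro: continuous_on_subset)
  have contE: "continuous_on {a..b} ?E"
    using contuw cont[THEN continuous_on_subset, OF sub] \<open>0 < a\<close>
    by (intro continuous_intros) auto
  have E0: "?E r = 0" if "r \<in> {0<..}" "r \<notin> {a..b}" for r
    using u(3)[OF that(2)] w(3)[OF that(2)] derivative_zero_off_interval[OF u(1,3) that(2)]
      derivative_zero_off_interval[OF w(1,3) that(2)] by simp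
  have E: "set_integrable lebesgue {0<..} ?E" "(LINT r:{0<..}|lebesgue. ?E r) = integral {a..b} ?E"
    by (rule set_lebesgue_integral_interval_support[OF contE sub], erule E0, assumption)+
  \<comment> \<open>Even for the zero function \<open>weak_deriv\<close> is a choice that is known
    only almost everywhere.\<close>
  have z: "AE r in lebesgue. r > 0 \<longrightarrow> weak_deriv (\<lambda>_. 0) r = 0"
    by (rule weak_deriv_C1) auto
  have ae: "AE r in lebesgue. indicator {0<..} r *\<^sub>R ?E r = indicator {0<..} r *\<^sub>R ?F r"
    using weak_deriv_C1[OF u(1,2)] weak_deriv_C1[OF w(1,2)] z
    by eventually_elim (auto simp: indicator_def)
  have meas: "(\<lambda>r. indicator {0<..} r *\<^sub>R ?E r) \<in> borel_measurable lebesgue"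
    using E(1) unfolding set_integrable_def by (rule borel_measurable_integrable)
  have "second_variation \<kappa> g d f S m u (\<lambda>_. 0) w = (LINT r|lebesgue. indicator {0<..} r *\<^sub>R ?F r)"
    by (simp only: second_variation_def set_lebesgue_integral_def)
  \<comment> \<open>The integrand containing \<open>weak_deriv\<close> gets its measurability from
    being almost everywhere equal to a measurable one, by completeness of Lebesgue measure.\<close>
  also have "\<dots> = (LINT r|lebesgue. indicator {0<..} r *\<^sub>R ?E r)"
    by (rule integral_cong_AE[OF borel_measurable_AE[OF meas ae] meas])
      (use ae in \<open>auto elim: eventually_mono\<close>)
  also have "\<dots> = integral {a..b} ?E"
    using E(2) by (simp only: set_lebesgue_integral_def)
  finally show ?thesis .
qed

text \<open>Gronwall argument in both directions: on the compact interval between \<open>r0\<close>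
  and \<open>r\<close> the quantity \<open>E = x^2 + x'^2\<close> satisfies
  \<open>|E'| \<le> K E\<close>, so \<open>E exp(-K t)\<close> is nonincreasing and
  \<open>E exp(K t)\<close> nondecreasing.\<close>

lemma linear_ode_unique_zero:
  fixes x x' P Q :: "real \<Rightarrow> real"
  assumes x: "\<And>r. r > 0 \<Longrightarrow> (x has_real_derivative x' r) (at r)"
    and x': "\<And>r. r > 0 \<Longrightarrow> (x' has_real_derivative P r * x' r + Q r * x r) (at r)"
    and cont: "continuous_on {0<..} P" "continuous_on {0<..} Q"
    and r0: "r0 > 0" "x r0 = 0" "x' r0 = 0" and "r > 0"
  shows "x r = 0"
proof -
  define E where "E t = (x t)\<^sup>2 + (x' t)\<^sup>2" for t
  define E' where "E' t = 2 * (x t * x' t) + 2 * (P t * (x' t * x' t)) + 2 * (Q t * (x t * x' t))" for t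
  define I where "I = {min r r0..max r r0}"
  have I: "I \<subseteq> {0<..}" "compact I" "r \<in> I" "r0 \<in> I" using r0 \<open>r > 0\<close> by (auto simp: I_def)
  have bdd: "\<exists>M. \<forall>t\<in>I. \<bar>F t\<bar> \<le> M" if "continuous_on {0<..} F" for F :: "real \<Rightarrow> real"
    using compact_imp_bounded[OF compact_continuous_image[OF continuous_on_subset[OF that I(1)] I(2)]]
    by (auto simp: bounded_iff)
  obtain M N where M: "\<And>t. t \<in> I \<Longrightarrow> \<bar>P t\<bar> \<le> M" and N: "\<And>t. t \<in> I \<Longrightarrow> \<bar>Q t\<bar> \<le> N"
    using bdd[OF cont(1)] bdd[OF cont(2)] by blast
  \<comment> \<open>The summands bound the contributions \<open>2 x x'\<close>,
    \<open>2 P x'^2\<close> and \<open>2 Q x x'\<close> to \<open>E'\<close>, in this order.\<close>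
  define K where "K = 1 + 2 * M + N"
  have dE: "(E has_real_derivative E' t) (at t)" if "t > 0" for t
    unfolding E_def[abs_def] E'_def using x[OF that] x'[OF that]
    by (auto intro!: derivative_eq_intros simp: algebra_simps)
  have bound: "\<bar>E' t\<bar> \<le> K * E t" if "t \<in> I" for t
  proof -
    have 1: "\<bar>2 * (x t * x' t)\<bar> \<le> E t"
      using sum_squares_bound[of "\<bar>x t\<bar>" "\<bar>x' t\<bar>"] by (simp add: E_def abs_mult)
    have "\<bar>P t * (x' t * x' t)\<bar> \<le> M * E t"
      unfolding abs_mult[of "P t"] using M[OF that] by (intro mult_mono) (auto simp: E_def power2_eq_square)
    moreover have "\<bar>2 * (Q t * (x t * x' t))\<bar> \<le> N * E t"
    proof -
      have "\<bar>2 * (Q t * (x t * x' t))\<bar> = \<bar>Q t\<bar> * \<bar>2 * (x t * x' t)\<bar>" by (simp add: abs_mult)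
      also have "\<dots> \<le> N * E t" using N[OF that] 1 by (intro mult_mono) (auto simp: E_def)
      finally show ?thesis .
    qed
    ultimately show ?thesis using 1 by (simp add: E'_def K_def algebra_simps)
  qed
  have "E r \<le> 0"
  proof (cases "r0 \<le> r")
    case True
    have "E r * exp (- K * r) \<le> E r0 * exp (- K * r0)"
    proof (rule DERIV_nonpos_imp_nonincreasing[of r0 r "\<lambda>t. E t * exp (- K * t)", OF True])
      fix t assume t: "r0 \<le> t" "t \<le> r"
      then have "t > 0" "t \<in> I" using r0 by (auto simp: I_def)
      have "((\<lambda>t. E t * exp (- K * t)) has_real_derivative (E' t - K * E t) * exp (- K * t)) (at t)"
        using dE[OF \<open>t > 0\<close>] by (auto intro!: derivative_eq_intros simp: algebra_simps)
      moreover have "(E' t - K * E t) * exp (- K * t) \<le> 0"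
        using bound[OF \<open>t \<in> I\<close>] by (intro mult_nonpos_nonneg) auto
      ultimately show "\<exists>y. ((\<lambda>t. E t * exp (- K * t)) has_real_derivative y) (at t) \<and> y \<le> 0" by blast
    qed
    then show ?thesis using r0 by (simp add: E_def mult_le_0_iff not_le[symmetric])
  next
    case False
    have "E r * exp (K * r) \<le> E r0 * exp (K * r0)"
    proof (rule DERIV_nonneg_imp_nondecreasing[of r r0 "\<lambda>t. E t * exp (K * t)"])
      show "r \<le> r0" using False by simp
      fix t assume t: "r \<le> t" "t \<le> r0"
      then have "t > 0" "t \<in> I" using \<open>r > 0\<close> by (auto simp: I_def)
      have "((\<lambda>t. E t * exp (K * t)) has_real_derivative (E' t + K * E t) * exp (K * t)) (at t)"
        using dE[OF \<open>t > 0\<close>] by (auto intro!: derivative_eq_intros simp: algebra_simps)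
      moreover have "(E' t + K * E t) * exp (K * t) \<ge> 0"
        using bound[OF \<open>t \<in> I\<close>] by (intro mult_nonneg_nonneg) auto
      ultimately show "\<exists>y. ((\<lambda>t. E t * exp (K * t)) has_real_derivative y) (at t) \<and> y \<ge> 0" by blast
    qed
    then show ?thesis using r0 by (simp add: E_def mult_le_0_iff not_le[symmetric])
  qed
  then show ?thesis by (simp add: E_def sum_power2_le_zero_iff)
qed

section \<open>Sign properties of solutions\<close>

locale GL_solution =
  fixes d :: int and g \<kappa> :: real and f S m :: "real \<Rightarrow> real"
  assumes d_nonzero: "d \<noteq> 0" and g_pos: "g > 0" and \<kappa>_pos: "\<kappa> > 0"
    and admissible: "admissible_solution \<kappa> g d f S m"
begin

definition a :: "real \<Rightarrow> real" where "a r = of_int d - S r"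
text \<open>With \<open>A\<close> and \<open>C\<close> the equations for \<open>f\<close> and
  \<open>m\<close> read \<open>f'' + f'/r = A f\<close> and \<open>m'' + m'/r = C m\<close>. They
  can be treated as linear equations with continuous coefficients, and uniqueness for those becomes
  available.\<close>

definition A :: "real \<Rightarrow> real" where "A r = (a r)\<^sup>2 / r\<^sup>2 - \<kappa>\<^sup>2 * (1 - (f r)\<^sup>2 - (m r)\<^sup>2)"
definition C :: "real \<Rightarrow> real" where "C r = \<kappa>\<^sup>2 * g - \<kappa>\<^sup>2 * (1 - (f r)\<^sup>2 - (m r)\<^sup>2)"
definition energy_density :: "real \<Rightarrow> real" where
  "energy_density r = (deriv f r)\<^sup>2 + (deriv S r / r)\<^sup>2 + (deriv m r)\<^sup>2 + \<kappa>\<^sup>2 * g * (m r)\<^sup>2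
     + (a r)\<^sup>2 * (f r)\<^sup>2 / r\<^sup>2 + \<kappa>\<^sup>2 / 2 * (1 - (f r)\<^sup>2 - (m r)\<^sup>2)\<^sup>2"

lemma f_nonneg: "r \<ge> 0 \<Longrightarrow> f r \<ge> 0" and m_nonneg: "r \<ge> 0 \<Longrightarrow> m r \<ge> 0"
  using admissible by (auto simp: admissible_solution_def)

lemma system:
  assumes "r > 0"
  shows "(f has_real_derivative deriv f r) (at r)" "(S has_real_derivative deriv S r) (at r)"
    "(m has_real_derivative deriv m r) (at r)"
    "(deriv f has_real_derivative - deriv f r / r + A r * f r) (at r)"
    "(deriv S has_real_derivative deriv S r / r - a r * (f r)\<^sup>2) (at r)"
    "(deriv m has_real_derivative - deriv m r / r + C r * m r) (at r)"
proof -
  have GL: "GL_system \<kappa> g d f S m" using admissible by (simp add: admissible_solution_def)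
  have d: "twice_differentiable_at f r" "twice_differentiable_at S r" "twice_differentiable_at m r"
    and e: "- deriv (deriv f) r - 1 / r * deriv f r + (of_int d - S r)\<^sup>2 / r\<^sup>2 * f r
       = \<kappa>\<^sup>2 * (1 - (f r)\<^sup>2 - (m r)\<^sup>2) * f r"
     "- deriv (deriv S) r + 1 / r * deriv S r = (of_int d - S r) * (f r)\<^sup>2"
     "- deriv (deriv m) r - 1 / r * deriv m r + \<kappa>\<^sup>2 * g * m r
       = \<kappa>\<^sup>2 * (1 - (f r)\<^sup>2 - (m r)\<^sup>2) * m r"
    using GL assms unfolding GL_system_def by blast+
  show "(f has_real_derivative deriv f r) (at r)" "(S has_real_derivative deriv S r) (at r)"
    "(m has_real_derivative deriv m r) (at r)"
    using d by (auto simp: twice_differentiable_at_def DERIV_deriv_iff_real_differentiable)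
  have "(deriv f has_real_derivative deriv (deriv f) r) (at r)"
    "(deriv S has_real_derivative deriv (deriv S) r) (at r)"
    "(deriv m has_real_derivative deriv (deriv m) r) (at r)"
    using d by (auto simp: twice_differentiable_at_def DERIV_deriv_iff_real_differentiable)
  moreover have "deriv (deriv f) r = - deriv f r / r + A r * f r"
    using e(1) by (simp add: A_def a_def algebra_simps)
  moreover have "deriv (deriv S) r = deriv S r / r - a r * (f r)\<^sup>2"
    using e(2) by (simp add: a_def algebra_simps)
  moreover have "deriv (deriv m) r = - deriv m r / r + C r * m r"
    using e(3) by (simp add: C_def algebra_simps)
  ultimately show "(deriv f has_real_derivative - deriv f r / r + A r * f r) (at r)"
    "(deriv S has_real_derivative deriv S r / r - a r * (f r)\<^sup>2) (at r)"
    "(deriv m has_real_derivative - deriv m r / r + C r * m r) (at r)" by simp_all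
qed

lemma a_deriv: "r > 0 \<Longrightarrow> (a has_real_derivative - deriv S r) (at r)"
  unfolding a_def[abs_def] by (auto intro!: derivative_eq_intros system)

lemma continuous_fields:
  "continuous_on {0<..} f" "continuous_on {0<..} S" "continuous_on {0<..} m"
  "continuous_on {0<..} (deriv f)" "continuous_on {0<..} (deriv S)" "continuous_on {0<..} (deriv m)"
  by (rule continuous_on_real_derivative, rule system, simp)+

lemma continuous_coefficients:
  "continuous_on {0<..} a" "continuous_on {0<..} A" "continuous_on {0<..} C"
proof -
  show a: "continuous_on {0<..} a"
    unfolding a_def[abs_def] by (intro continuous_intros continuous_fields)
  show "continuous_on {0<..} A" "continuous_on {0<..} C"
    unfolding A_def[abs_def] C_def[abs_def] by (intro continuous_intros continuous_fields a; simp)+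
qed

section \<open>Consequences of finite energy at infinity\<close>

lemma energy_finite: "(\<integral>\<^sup>+ r\<in>{0<..}. ennreal (energy_density r * r) \<partial>lebesgue) < \<infinity>"
proof -
  have "1 / 2 * (\<integral>\<^sup>+ r\<in>{0<..}. ennreal (energy_density r * r) \<partial>lebesgue) < \<infinity>"
    using admissible unfolding admissible_solution_def GL_energy_def energy_density_def a_def by blast
  then show ?thesis by (auto simp: ennreal_mult_less_top divide_eq_0_iff less_top)
qed

text \<open>Otherwise the energy over an interval of length \<open>n\<close> far out would be at
  least \<open>c n\<close> for every \<open>n\<close>; starting beyond 1 makes the weight
  \<open>r\<close> harmless.\<close>

lemma energy_density_small:
  assumes "c > 0"
  shows "\<exists>r>0. r \<ge> R \<and> energy_density r < c"
proof (rule ccontr)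
  define R' where "R' = max R 1"
  let ?I = "\<integral>\<^sup>+ r\<in>{0<..}. ennreal (energy_density r * r) \<partial>lebesgue"
  assume neg: "\<not> (\<exists>r>0. r \<ge> R \<and> energy_density r < c)"
  have ge: "c \<le> energy_density r" if "r \<ge> R'" for r
  proof -
    have "r > 0" "r \<ge> R" using that by (auto simp: R'_def)
    then show ?thesis using neg not_le by blast
  qed
  have I: "ennreal (c * real n) \<le> ?I" for n
  proof -
    have "ennreal (c * real n) = ennreal c * emeasure lebesgue {R'..R' + real n}"
      using assms by (simp add: ennreal_mult)
    also have "\<dots> = (\<integral>\<^sup>+ r. ennreal c * indicator {R'..R' + real n} r \<partial>lebesgue)"
      by (rule nn_integral_cmult_indicator[symmetric]) simp
    also have "\<dots> \<le> ?I"
    proof (rule nn_integral_mono)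
      fix r
      show "ennreal c * indicator {R'..R' + real n} r \<le> ennreal (energy_density r * r) * indicator {0<..} r"
      proof (cases "r \<in> {R'..R' + real n}")
        case True
        then have "r \<ge> R'" "r \<ge> 1" by (auto simp: R'_def)
        then have "c * 1 \<le> energy_density r * r"
          using ge[of r] assms by (intro mult_mono) auto
        then show ?thesis using True \<open>r \<ge> 1\<close> by (simp add: ennreal_leI)
      qed simp
    qed
    finally show ?thesis .
  qed
  obtain e where e: "?I = ennreal e" "e \<ge> 0"
    using energy_finite by (cases ?I) auto
  obtain n where "e / c < real n" using reals_Archimedean2 by blast
  then have "e < c * real n" using assms by (simp add: field_simps)
  moreover have "c * real n \<le> e" using I[of n] e by simp
  ultimately show False by simp
qed

text \<open>With \<open>t = f^2 + m^2\<close> one has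
  \<open>t + (1 - t)^2 = (t - 1/2)^2 + 3/4\<close>: the fields cannot be small while the potential
  term is small too. The mass term controls \<open>m^2\<close>, and the hypothesis lets the term
  \<open>a^2 f^2 / r^2\<close> control \<open>f^2\<close>.\<close>

lemma energy_density_lower_bound:
  assumes "(a r)\<^sup>2 / r\<^sup>2 \<ge> c \<or> f r = 0" and "0 < c"
  shows "energy_density r \<ge> min (\<kappa>\<^sup>2 * g) (min c (\<kappa>\<^sup>2 / 2)) * (3 / 4)"
proof -
  define k where "k = min (\<kappa>\<^sup>2 * g) (min c (\<kappa>\<^sup>2 / 2))"
  have k: "0 \<le> k" "k \<le> \<kappa>\<^sup>2 * g" "k \<le> c" "k \<le> \<kappa>\<^sup>2 / 2"
    using assms g_pos \<kappa>_pos by (auto simp: k_def)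
  have "k * (f r)\<^sup>2 \<le> (a r)\<^sup>2 * (f r)\<^sup>2 / r\<^sup>2"
  proof (cases "f r = 0")
    case False
    then have "k * (f r)\<^sup>2 \<le> (a r)\<^sup>2 / r\<^sup>2 * (f r)\<^sup>2"
      using assms k by (intro mult_right_mono) auto
    then show ?thesis by simp
  qed simp
  moreover have "k * (m r)\<^sup>2 \<le> \<kappa>\<^sup>2 * g * (m r)\<^sup>2" using k by (intro mult_right_mono) auto
  moreover have "k * (1 - (f r)\<^sup>2 - (m r)\<^sup>2)\<^sup>2 \<le> \<kappa>\<^sup>2 / 2 * (1 - (f r)\<^sup>2 - (m r)\<^sup>2)\<^sup>2"
    using k by (intro mult_right_mono) auto
  ultimately have "k * ((f r)\<^sup>2 + (m r)\<^sup>2 + (1 - (f r)\<^sup>2 - (m r)\<^sup>2)\<^sup>2) \<le> energy_density r"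
    by (simp add: energy_density_def algebra_simps add_increasing)
  moreover have "3 / 4 \<le> (f r)\<^sup>2 + (m r)\<^sup>2 + (1 - (f r)\<^sup>2 - (m r)\<^sup>2)\<^sup>2"
  proof -
    have "0 \<le> ((f r)\<^sup>2 + (m r)\<^sup>2 - 1 / 2)\<^sup>2" by simp
    then show ?thesis by (simp add: power2_eq_square algebra_simps)
  qed
  then have "k * (3 / 4) \<le> k * ((f r)\<^sup>2 + (m r)\<^sup>2 + (1 - (f r)\<^sup>2 - (m r)\<^sup>2)\<^sup>2)"
    using k(1) by (rule mult_left_mono)
  ultimately show ?thesis unfolding k_def by linarith
qed

text \<open>Used in two ways: \<open>a^2\<close> cannot grow quadratically, and \<open>f\<close>
  cannot vanish identically.\<close>

lemma energy_not_bounded_below: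
  assumes "c > 0"
  obtains r where "r > 0" "r \<ge> R" "(a r)\<^sup>2 / r\<^sup>2 < c" "f r \<noteq> 0"
proof -
  have "0 < min (\<kappa>\<^sup>2 * g) (min c (\<kappa>\<^sup>2 / 2)) * (3 / 4)"
    using assms g_pos \<kappa>_pos by simp
  then obtain r where "r > 0" "r \<ge> R" "energy_density r < min (\<kappa>\<^sup>2 * g) (min c (\<kappa>\<^sup>2 / 2)) * (3 / 4)"
    using energy_density_small by blast
  then have "\<not> ((a r)\<^sup>2 / r\<^sup>2 \<ge> c \<or> f r = 0)"
    using energy_density_lower_bound[of c r] assms by linarith
  then have "(a r)\<^sup>2 / r\<^sup>2 < c" "f r \<noteq> 0" by auto
  with \<open>r > 0\<close> \<open>r \<ge> R\<close> show thesis by (rule that)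
qed

section \<open>Sign and non-vanishing of the gauge component\<close>

definition a_rate :: "real \<Rightarrow> real" where "a_rate r = - (a r * deriv S r) / r"

text \<open>The second equation of the system in divergence form is
  \<open>(S'/r)' = - a f^2 / r\<close>. The product rule for \<open>- a (S'/r)\<close> then produces
  two squares.\<close>

lemma a_rate_deriv:
  assumes "r > 0"
  shows "(a_rate has_real_derivative (deriv S r)\<^sup>2 / r + (a r)\<^sup>2 * (f r)\<^sup>2 / r) (at r)"
  unfolding a_rate_def[abs_def] using assms
  by (auto intro!: derivative_eq_intros a_deriv system simp: power2_eq_square field_simps)

lemma a_rate_mono:
  assumes "0 < r" "r \<le> s"
  shows "a_rate r \<le> a_rate s"
proof (rule DERIV_nonneg_imp_nondecreasing[OF assms(2)])
  fix t assume "r \<le> t" "t \<le> s"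
  then have "t > 0" using assms by simp
  then show "\<exists>z. (a_rate has_real_derivative z) (at t) \<and> 0 \<le> z"
    using a_rate_deriv[OF \<open>t > 0\<close>] by (intro exI[of _ "(deriv S t)\<^sup>2 / t + (a t)\<^sup>2 * (f t)\<^sup>2 / t"] conjI) auto
qed

text \<open>
  If \<open>a_rate\<close>, which is \<open>(a\<^sup>2)' / 2r\<close>, were positive somewhere, \<open>a\<^sup>2\<close> would grow quadratically.
  Then \<open>f\<^sup>2\<close> would have to be integrable against \<open>r dr\<close>, which is incompatible with the
  terms \<open>m\<^sup>2\<close> and \<open>(1 - f\<^sup>2 - m\<^sup>2)\<^sup>2\<close> of the energy.
\<close>

lemma a_rate_nonpos:
  assumes "r > 0"
  shows "a_rate r \<le> 0"
proof (rule ccontr)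
  define c where "c = a_rate r"
  assume "\<not> a_rate r \<le> 0"
  then have c: "c > 0" by (simp add: c_def)
  have grow: "c * s\<^sup>2 - c * r\<^sup>2 \<le> (a s)\<^sup>2" if "r \<le> s" for s
  proof -
    have "(a r)\<^sup>2 - c * r\<^sup>2 \<le> (a s)\<^sup>2 - c * s\<^sup>2"
    proof (rule DERIV_nonneg_imp_nondecreasing[of r s "\<lambda>t. (a t)\<^sup>2 - c * t\<^sup>2", OF that])
      fix t assume t: "r \<le> t" "t \<le> s"
      then have "t > 0" using assms by simp
      have "((\<lambda>t. (a t)\<^sup>2 - c * t\<^sup>2) has_real_derivative 2 * t * (a_rate t - c)) (at t)"
        using \<open>t > 0\<close> a_deriv[OF \<open>t > 0\<close>]
        by (auto intro!: derivative_eq_intros simp: a_rate_def field_simps)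
      moreover have "c \<le> a_rate t" using a_rate_mono[OF assms t(1)] by (simp add: c_def)
      ultimately show "\<exists>z. ((\<lambda>t. (a t)\<^sup>2 - c * t\<^sup>2) has_real_derivative z) (at t) \<and> 0 \<le> z"
        using \<open>t > 0\<close> by (intro exI[of _ "2 * t * (a_rate t - c)"] conjI) auto
    qed
    then show ?thesis using zero_le_power2[of "a r"] by linarith
  qed
  \<comment> \<open>For \<open>s \<ge> 2 r\<close> the growth bound gives at least
    \<open>(3/4) c s^2\<close>, which exceeds the threshold \<open>(c/2) s^2\<close>.\<close>
  have "c / 2 > 0" using c by simp
  then obtain s where s: "s > 0" "s \<ge> 2 * r" "(a s)\<^sup>2 / s\<^sup>2 < c / 2"
    by (rule energy_not_bounded_below[of _ "2 * r"])
  have "(2 * r)\<^sup>2 \<le> s\<^sup>2" using s assms by (intro power_mono) auto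
  then have "c * (4 * r\<^sup>2) \<le> c * s\<^sup>2" using c by (intro mult_left_mono) (auto simp: power_mult_distrib)
  moreover have "0 \<le> c * s\<^sup>2" using c by simp
  moreover have "c * s\<^sup>2 - c * r\<^sup>2 \<le> (a s)\<^sup>2" using grow s assms by simp
  ultimately have "c / 2 * s\<^sup>2 \<le> (a s)\<^sup>2" by simp
  then have "c / 2 \<le> (a s)\<^sup>2 / s\<^sup>2" using s(1) by (simp add: pos_le_divide_eq)
  then show False using s(3) by simp
qed

lemma a_S_nonneg:
  assumes "r > 0"
  shows "0 \<le> a r * deriv S r"
  using a_rate_nonpos[OF assms] assms by (simp add: a_rate_def field_simps)

text \<open>At a zero of \<open>a\<close> the monotone, nonpositive function \<open>a_rate\<close>
  is 0, hence it stays 0 from there on. Both squares in its derivative then vanish, so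
  \<open>a\<close> is constantly 0 to the right. Linear uniqueness carries this back to all of
  (0,\<infinity>), where it contradicts \<open>S(0) = 0\<close> and
  \<open>d \<noteq> 0\<close>.\<close>

lemma a_nonzero:
  assumes "r > 0"
  shows "a r \<noteq> 0"
proof
  assume ar: "a r = 0"
  have rate0: "a_rate s = 0" if "s \<ge> r" for s
  proof -
    have "a_rate r = 0" using ar by (simp add: a_rate_def)
    then show ?thesis using a_rate_mono[OF assms that] a_rate_nonpos[of s] assms that by linarith
  qed
  have S0: "deriv S s = 0" if "s > r" for s
  proof -
    have "(a_rate has_real_derivative 0) (at s)"
      using \<open>s > r\<close> rate0
      by (intro DERIV_cong_ev[OF refl _ refl, of a_rate "\<lambda>_. 0", THEN iffD2])
        (auto intro!: eventually_mono[OF eventually_nhds_in_open[of "{r<..}" s]])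
    from DERIV_unique[OF this a_rate_deriv, of] assms \<open>s > r\<close>
    have "(deriv S s)\<^sup>2 / s + (a s)\<^sup>2 * (f s)\<^sup>2 / s = 0" by simp
    moreover have "0 \<le> (deriv S s)\<^sup>2 / s" "0 \<le> (a s)\<^sup>2 * (f s)\<^sup>2 / s"
      using assms \<open>s > r\<close> by auto
    ultimately have "(deriv S s)\<^sup>2 / s = 0" by linarith
    then show ?thesis using assms \<open>s > r\<close> by simp
  qed
  have "a s = 0" if "s > r" for s
  proof -
    have "continuous_on {r..s} a"
      using continuous_coefficients(1) assms by (auto intro: continuous_on_subset)
    moreover have "(a has_real_derivative 0) (at t)" if "r < t" for t
      using a_deriv[of t] S0[OF that] assms that by simp
    ultimately show ?thesis
      using DERIV_isconst_end[of r s a] \<open>s > r\<close> ar by simp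
  qed
  \<comment> \<open>The Cauchy data are taken at \<open>r + 1\<close> because \<open>S' = 0\<close>
    has been obtained only strictly to the right of \<open>r\<close>.\<close>
  then have s: "a (r + 1) = 0" "deriv S (r + 1) = 0" using S0[of "r + 1"] by auto
  have a0: "a t = 0" if "t > 0" for t
  proof (rule linear_ode_unique_zero[of a "\<lambda>t. - deriv S t" "\<lambda>t. 1 / t" "\<lambda>t. (f t)\<^sup>2" "r + 1"])
    show "((\<lambda>t. - deriv S t) has_real_derivative 1 / t * - deriv S t + (f t)\<^sup>2 * a t) (at t)" if "t > 0" for t
      using system(5)[OF that] by (auto intro!: derivative_eq_intros simp: algebra_simps)
    show "continuous_on {0<..} (\<lambda>t::real. 1 / t)" by (intro continuous_intros) auto
    show "continuous_on {0<..} (\<lambda>t. (f t)\<^sup>2)" by (intro continuous_intros continuous_fields)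
  qed (use s assms that a_deriv in auto)
  have "(S \<longlongrightarrow> S 0) (at_right 0)"
  proof (rule tendsto_within_subset)
    show "(S \<longlongrightarrow> S 0) (at 0 within {0..})"
      using admissible unfolding admissible_solution_def continuous_within by blast
  qed auto
  moreover have "\<forall>\<^sub>F t in at_right 0. S t = of_int d"
    using a0 by (auto simp: eventually_at_right_field a_def intro!: exI[of _ 1])
  ultimately have "((\<lambda>_::real. of_int d) \<longlongrightarrow> S 0) (at_right 0)"
    using tendsto_cong[of S "\<lambda>_. of_int d" "at_right 0"] by blast
  then have "S 0 = of_int d" by (simp add: tendsto_const_iff)
  then show False using admissible d_nonzero by (simp add: admissible_solution_def)
qed

section \<open>Positivity of the fields\<close>

lemma nonneg_zero_imp_deriv_zero:
  assumes "r > 0" and "h r = 0" and "(h has_real_derivative D) (at r)" and "\<And>t. t > 0 \<Longrightarrow> h t \<ge> (0::real)"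
  shows "D = 0"
proof (rule DERIV_local_min[OF assms(3,1)], intro allI impI)
  fix t assume "\<bar>r - t\<bar> < r"
  then have "t > 0" by linarith
  then show "h r \<le> h t" using assms(2,4) by simp
qed

text \<open>A zero of a nonnegative function is a minimum, so \<open>f\<close> and \<open>f'\<close>
  vanish together and linear uniqueness gives \<open>f = 0\<close> everywhere. Finite energy
  excludes that.\<close>

lemma f_pos:
  assumes "r > 0"
  shows "f r > 0"
proof (rule ccontr)
  assume "\<not> f r > 0"
  then have fr: "f r = 0" using f_nonneg[of r] assms by simp
  then have dfr: "deriv f r = 0"
    using nonneg_zero_imp_deriv_zero[OF assms fr system(1)[OF assms]] f_nonneg by simp
  have "f t = 0" if "t > 0" for t
  proof (rule linear_ode_unique_zero[of f "deriv f" "\<lambda>t. - 1 / t" A r])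
    show "(deriv f has_real_derivative - 1 / t * deriv f t + A t * f t) (at t)" if "t > 0" for t
      using system(4)[OF that] by simp
    show "continuous_on {0<..} (\<lambda>t::real. - 1 / t)" by (intro continuous_intros) auto
  qed (use fr dfr assms that system continuous_coefficients in auto)
  moreover obtain s where "s > 0" "f s \<noteq> 0" using energy_not_bounded_below[of 1] by auto
  ultimately show False by blast
qed

lemma m_pos:
  assumes "r > 0" and "\<exists>r\<ge>0. m r \<noteq> 0"
  shows "m r > 0"
proof (rule ccontr)
  assume "\<not> m r > 0"
  then have mr: "m r = 0" using m_nonneg[of r] assms by simp
  then have dmr: "deriv m r = 0"
    using nonneg_zero_imp_deriv_zero[OF assms(1) mr system(3)[OF assms(1)]] m_nonneg by simp
  have m0: "m t = 0" if "t > 0" for t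
  proof (rule linear_ode_unique_zero[of m "deriv m" "\<lambda>t. - 1 / t" C r])
    show "(deriv m has_real_derivative - 1 / t * deriv m t + C t * m t) (at t)" if "t > 0" for t
      using system(6)[OF that] by simp
    show "continuous_on {0<..} (\<lambda>t::real. - 1 / t)" by (intro continuous_intros) auto
  qed (use mr dmr assms that system continuous_coefficients in auto)
  \<comment> \<open>The point where \<open>m\<close> is nonzero could be 0 itself. Continuity there
    comes from the one-sided derivative in the definition of an admissible solution.\<close>
  have "(m \<longlongrightarrow> m 0) (at 0 within {0..})"
    using admissible DERIV_continuous[of m 0 0 "{0..}"]
    unfolding admissible_solution_def continuous_within by blast
  then have "(m \<longlongrightarrow> m 0) (at_right 0)"
    by (rule tendsto_within_subset) auto
  moreover have "\<forall>\<^sub>F t in at_right 0. m t = 0"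
    using m0 by (auto simp: eventually_at_right_field intro!: exI[of _ 1])
  ultimately have "((\<lambda>_::real. 0) \<longlongrightarrow> m 0) (at_right 0)"
    using tendsto_cong[of m "\<lambda>_. 0" "at_right 0"] by blast
  then have "m 0 = 0" by (simp add: tendsto_const_iff)
  then have "m t = 0" if "t \<ge> 0" for t using m0[of t] that by (cases "t = 0") auto
  then show False using assms(2) by blast
qed

end

section \<open>Truncation\<close>

text \<open>
  \<open>smooth_neg \<delta>\<close> approximates \<open>min x 0\<close>. It is concave, so its second derivative enters the estimates
  below with a favourable sign.
\<close>

definition smooth_neg :: "real \<Rightarrow> real \<Rightarrow> real" where
  "smooth_neg \<delta> x = (x - sqrt (x\<^sup>2 + \<delta>\<^sup>2)) / 2"
definition smooth_neg' :: "real \<Rightarrow> real \<Rightarrow> real" where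
  "smooth_neg' \<delta> x = (1 - x / sqrt (x\<^sup>2 + \<delta>\<^sup>2)) / 2"
definition smooth_neg'' :: "real \<Rightarrow> real \<Rightarrow> real" where
  "smooth_neg'' \<delta> x = - \<delta>\<^sup>2 / (2 * sqrt (x\<^sup>2 + \<delta>\<^sup>2) ^ 3)"

lemma smooth_neg_deriv:
  assumes "\<delta> > 0"
  shows "(smooth_neg \<delta> has_real_derivative smooth_neg' \<delta> x) (at x)"
    and "(smooth_neg' \<delta> has_real_derivative smooth_neg'' \<delta> x) (at x)"
proof -
  have pos: "x\<^sup>2 + \<delta>\<^sup>2 > 0" using assms by (simp add: add_nonneg_pos)
  define s where "s = sqrt (x\<^sup>2 + \<delta>\<^sup>2)"
  have s: "s > 0" "s\<^sup>2 = x\<^sup>2 + \<delta>\<^sup>2" using pos by (auto simp: s_def)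
  have ds: "((\<lambda>x. sqrt (x\<^sup>2 + \<delta>\<^sup>2)) has_real_derivative x / s) (at x)"
    using pos unfolding s_def by (auto intro!: derivative_eq_intros simp: field_simps)
  show "(smooth_neg \<delta> has_real_derivative smooth_neg' \<delta> x) (at x)"
    unfolding smooth_neg_def[abs_def] smooth_neg'_def s_def[symmetric]
    by (rule derivative_eq_intros ds refl | simp)+
  have "((\<lambda>x. (1 - x / sqrt (x\<^sup>2 + \<delta>\<^sup>2)) / 2) has_real_derivative
      (0 - (1 * s - x * (x / s)) / (s * s)) / 2) (at x)"
    unfolding s_def
    by (intro DERIV_cdivide DERIV_diff DERIV_const DERIV_divide DERIV_ident ds[unfolded s_def])
      (use pos in auto)
  moreover have "(0 - (1 * s - x * (x / s)) / (s * s)) / 2 = smooth_neg'' \<delta> x"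
  proof -
    have "s - x * (x / s) = \<delta>\<^sup>2 / s" using s by (simp add: field_simps power2_eq_square)
    then show ?thesis unfolding smooth_neg''_def s_def[symmetric]
      by (simp add: power3_eq_cube mult.assoc)
  qed
  ultimately show "(smooth_neg' \<delta> has_real_derivative smooth_neg'' \<delta> x) (at x)"
    unfolding smooth_neg'_def[abs_def] by simp
qed

text \<open>The last two bounds concern the defect \<open>x F'(x) - F(x)\<close>, which is 0 for the
  homogeneous function \<open>min x 0\<close> away from the origin. Here it equals
  \<open>\<delta>^2 / (2 sqrt(x^2 + \<delta>^2))\<close>, and it measures the error of replacing
  \<open>x F'(x)\<close> by \<open>F(x)\<close> in the tested equation.\<close>

lemma smooth_neg_bounds:
  assumes "\<delta> > 0"
  shows "smooth_neg \<delta> x \<le> min x 0" "min x 0 - \<delta> / 2 \<le> smooth_neg \<delta> x"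
    "0 \<le> smooth_neg' \<delta> x" "smooth_neg' \<delta> x \<le> 1" "smooth_neg'' \<delta> x \<le> 0"
    "0 \<le> x * smooth_neg' \<delta> x - smooth_neg \<delta> x" "x * smooth_neg' \<delta> x - smooth_neg \<delta> x \<le> \<delta> / 2"
proof -
  define s where "s = sqrt (x\<^sup>2 + \<delta>\<^sup>2)"
  have pos: "x\<^sup>2 + \<delta>\<^sup>2 > 0" using assms by (simp add: add_nonneg_pos)
  have s: "s > 0" "s\<^sup>2 = x\<^sup>2 + \<delta>\<^sup>2" using pos by (auto simp: s_def)
  have le: "\<bar>x\<bar> \<le> s" "\<delta> \<le> s" using assms by (auto simp: s_def intro: real_le_rsqrt)
  have up: "s \<le> \<bar>x\<bar> + \<delta>" unfolding s_def using assms by (intro sqrt_sum_squares_le_sum[of "\<bar>x\<bar>", simplified]) auto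
  show "smooth_neg \<delta> x \<le> min x 0" "min x 0 - \<delta> / 2 \<le> smooth_neg \<delta> x"
    using le up unfolding smooth_neg_def s_def[symmetric] by (auto simp: min_def abs_if split: if_splits)
  show "0 \<le> smooth_neg' \<delta> x" "smooth_neg' \<delta> x \<le> 1" "smooth_neg'' \<delta> x \<le> 0"
    using le s unfolding smooth_neg'_def smooth_neg''_def s_def[symmetric] by (auto simp: field_simps)
  have "x * smooth_neg' \<delta> x - smooth_neg \<delta> x = (s - x\<^sup>2 / s) / 2"
    unfolding smooth_neg'_def smooth_neg_def s_def[symmetric]
    by (simp add: field_simps power2_eq_square)
  also have "\<dots> = \<delta>\<^sup>2 / s / 2" using s by (simp add: field_simps power2_eq_square)
  finally have e: "x * smooth_neg' \<delta> x - smooth_neg \<delta> x = \<delta>\<^sup>2 / s / 2" .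
  show "0 \<le> x * smooth_neg' \<delta> x - smooth_neg \<delta> x" "x * smooth_neg' \<delta> x - smooth_neg \<delta> x \<le> \<delta> / 2"
    unfolding e using s le assms by (auto simp: field_simps power2_eq_square)
qed

lemma smooth_neg_square_le:
  assumes "0 < \<delta>" "\<delta> \<le> 1"
  shows "(smooth_neg \<delta> x)\<^sup>2 \<le> (min x 0)\<^sup>2 + \<delta> * (\<bar>x\<bar> + 1)"
    and "(min x 0)\<^sup>2 \<le> (smooth_neg \<delta> x)\<^sup>2" and "- smooth_neg \<delta> x \<le> \<bar>x\<bar> + 1"
proof -
  define P where "P = min x 0"
  define F where "F = smooth_neg \<delta> x"
  have b: "F \<le> P" "P - \<delta> / 2 \<le> F" "P \<le> 0" "- P \<le> \<bar>x\<bar>"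
    using smooth_neg_bounds[OF assms(1), of x] by (auto simp: P_def F_def)
  show "- smooth_neg \<delta> x \<le> \<bar>x\<bar> + 1" using b assms unfolding F_def[symmetric] by linarith
  show "(min x 0)\<^sup>2 \<le> (smooth_neg \<delta> x)\<^sup>2"
    using power_mono[of "- P" "- F" 2] b unfolding F_def[symmetric] P_def[symmetric] by simp
  have "F\<^sup>2 - P\<^sup>2 = (P - F) * (- F - P)" by (simp add: power2_eq_square algebra_simps)
  also have "\<dots> \<le> (\<delta> / 2) * (2 * \<bar>x\<bar> + 1)"
    using b assms by (intro mult_mono) auto
  also have "\<dots> \<le> \<delta> * (\<bar>x\<bar> + 1)" using assms by (simp add: algebra_simps)
  finally show "(smooth_neg \<delta> x)\<^sup>2 \<le> (min x 0)\<^sup>2 + \<delta> * (\<bar>x\<bar> + 1)"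
    unfolding F_def[symmetric] P_def[symmetric] by linarith
qed

text \<open>
  The first two summands on the right are the derivative of \<open>r x' \<eta>\<^sup>2 \<Phi>(x) \<Phi>'(x)\<close> along a solution of
  \<open>(r x')' = (1/r + r \<alpha>) x - R\<close>, so they integrate to \<open>0\<close>.
\<close>

lemma truncated_component_estimate:
  fixes r x x1 \<Phi> \<Phi>' \<Phi>'' \<eta> \<eta>' \<alpha> \<epsilon> R :: real
  assumes "r > 0" and "\<Phi> \<le> 0" and "\<Phi>'' \<le> 0" and e: "0 \<le> x * \<Phi>' - \<Phi>" "x * \<Phi>' - \<Phi> \<le> \<epsilon>"
  shows "((\<eta>' * \<Phi> + \<eta> * \<Phi>' * x1)\<^sup>2 + \<alpha> * (\<eta> * \<Phi>)\<^sup>2) * r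
    \<le> ((1 / r + r * \<alpha>) * x - R) * (\<eta>\<^sup>2 * \<Phi> * \<Phi>')
       + r * x1 * (2 * \<eta> * \<eta>' * \<Phi> * \<Phi>' + \<eta>\<^sup>2 * (\<Phi>'\<^sup>2 + \<Phi> * \<Phi>'') * x1)
       + R * (\<eta>\<^sup>2 * \<Phi> * \<Phi>') + r * \<eta>'\<^sup>2 * \<Phi>\<^sup>2 - \<eta>\<^sup>2 * \<Phi>\<^sup>2 / r
       + \<eta>\<^sup>2 * \<epsilon> * (r * \<bar>\<alpha>\<bar> + 1 / r) * (- \<Phi>)"
proof -
  \<comment> \<open>With \<open>x \<Phi>' = \<Phi> + t\<close> the zeroth-order part of the tested
    equation becomes \<open>(1/r + r \<alpha>) \<eta>^2 \<Phi>^2\<close> plus an error in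
    \<open>t\<close>; its share \<open>\<eta>^2 \<Phi>^2 / r\<close> is the gain subtracted in the
    claim.\<close>
  define t where "t = x * \<Phi>' - \<Phi>"
  have x: "x * \<Phi>' = \<Phi> + t" by (simp add: t_def)
  have "(1 / r + r * \<alpha>) * t \<le> (r * \<bar>\<alpha>\<bar> + 1 / r) * \<epsilon>"
    using assms by (intro mult_mono) (auto simp: t_def intro: mult_left_mono)
  then have "\<eta>\<^sup>2 * (- \<Phi>) * ((1 / r + r * \<alpha>) * t) \<le> \<eta>\<^sup>2 * (- \<Phi>) * ((r * \<bar>\<alpha>\<bar> + 1 / r) * \<epsilon>)"
    using assms by (intro mult_left_mono) (auto intro: mult_nonneg_nonpos)
  \<comment> \<open>Concavity enters here: \<Phi> and \<Phi>'' are both nonpositive.\<close>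
  moreover have "0 \<le> r * \<eta>\<^sup>2 * (\<Phi> * \<Phi>'') * x1\<^sup>2"
    using assms by (intro mult_nonneg_nonneg mult_nonpos_nonpos) auto
  moreover have "(1 / r + r * \<alpha>) * x * (\<eta>\<^sup>2 * \<Phi> * \<Phi>') = (1 / r + r * \<alpha>) * (\<eta>\<^sup>2 * \<Phi>) * (\<Phi> + t)"
    unfolding x[symmetric] by simp
  ultimately show ?thesis
    by (simp add: algebra_simps power2_eq_square add_divide_distrib)
qed

text \<open>As \<open>P P' \<le> 0\<close>, replacing \<open>q\<close> by the smaller
  \<open>Q\<close> increases \<open>q P P'\<close>; then \<open>P Q \<ge> 0\<close> and
  \<open>P' \<le> 1\<close> give \<open>P Q\<close>. The total \<open>2 P Q\<close> is what the
  mixed term of the second variation cancels.\<close>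

lemma cooperative_bound:
  fixes p q P Q P' Q' :: real
  assumes "P \<le> p" "Q \<le> q" "P \<le> 0" "Q \<le> 0" "0 \<le> P'" "P' \<le> 1" "0 \<le> Q'" "Q' \<le> 1"
  shows "q * (P * P') + p * (Q * Q') \<le> 2 * (P * Q)"
proof -
  have *: "y * (X * X') \<le> X * Y" if "Y \<le> y" "X \<le> 0" "Y \<le> 0" "0 \<le> X'" "X' \<le> 1" for X X' Y y :: real
  proof -
    have "y * (X * X') \<le> Y * (X * X')"
      using that by (intro mult_right_mono_neg mult_nonpos_nonneg) auto
    also have "\<dots> = (X * Y) * X'" by simp
    also have "\<dots> \<le> (X * Y) * 1"
      using that by (intro mult_left_mono mult_nonpos_nonpos) auto
    finally show ?thesis by simp
  qed
  show ?thesis using *[of Q q P P'] *[of P p Q Q'] assms by (simp add: mult.commute)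
qed

lemma nonneg_if_nonneg_perturbed:
  fixes I K :: real
  assumes "\<And>\<delta>. 0 < \<delta> \<Longrightarrow> \<delta> \<le> 1 \<Longrightarrow> 0 \<le> I + \<delta> * K"
  shows "0 \<le> I"
proof (rule ccontr)
  assume "\<not> 0 \<le> I"
  define \<delta> where "\<delta> = min 1 (- I / (2 * (\<bar>K\<bar> + 1)))"
  have "0 < \<delta>" "\<delta> \<le> 1" using \<open>\<not> 0 \<le> I\<close> by (auto simp: \<delta>_def intro!: divide_neg_pos)
  have "\<delta> * K \<le> \<delta> * (\<bar>K\<bar> + 1)" using \<open>0 < \<delta>\<close> by (intro mult_left_mono) auto
  also have "\<dots> \<le> - I / (2 * (\<bar>K\<bar> + 1)) * (\<bar>K\<bar> + 1)" by (intro mult_right_mono) (auto simp: \<delta>_def)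
  also have "\<dots> = - I / 2"
  proof -
    have "\<bar>K\<bar> + 1 \<noteq> 0" by linarith
    then show ?thesis by (simp add: field_simps)
  qed
  finally show False using assms[OF \<open>0 < \<delta>\<close> \<open>\<delta> \<le> 1\<close>] \<open>\<not> 0 \<le> I\<close> by linarith
qed

lemma continuous_on_UNIV_zero_extension:
  fixes F :: "real \<Rightarrow> real"
  assumes "continuous_on {0<..} F" and "0 < lo" and "\<And>r. r < lo \<Longrightarrow> F r = 0"
  shows "continuous_on UNIV F"
proof -
  have "continuous_on {..<lo} (\<lambda>_. 0 :: real)" by (rule continuous_on_const)
  then have "continuous_on {..<lo} F"
    by (rule continuous_on_eq) (use assms(3) in auto)
  then have "continuous_on ({0<..} \<union> {..<lo}) F"
    using assms(1) by (intro continuous_on_open_Un) auto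
  moreover have "{0<..} \<union> {..<lo} = UNIV" using assms(2) by auto
  ultimately show ?thesis by simp
qed

section \<open>The differentiated system and truncation of its solutions\<close>

context GL_solution
begin

abbreviation p :: "real \<Rightarrow> real" where "p \<equiv> deriv f"
definition q :: "real \<Rightarrow> real" where "q r = - deriv m r"
definition p' :: "real \<Rightarrow> real" where "p' r = - p r / r + A r * f r"
definition q' :: "real \<Rightarrow> real" where "q' r = - q r / r - C r * m r"
definition A\<^sub>1 :: "real \<Rightarrow> real" where "A\<^sub>1 r = A r + 2 * \<kappa>\<^sup>2 * (f r)\<^sup>2"
definition A\<^sub>2 :: "real \<Rightarrow> real" where "A\<^sub>2 r = C r + 2 * \<kappa>\<^sup>2 * (m r)\<^sup>2"
definition B :: "real \<Rightarrow> real" where "B r = 2 * \<kappa>\<^sup>2 * f r * m r"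
text \<open>Equal to \<open>- (a^2/r^2)' f\<close>, the source left over when the potential in the
  equation for \<open>f\<close> is differentiated.\<close>

definition h :: "real \<Rightarrow> real" where "h r = (2 * (a r * deriv S r) / r\<^sup>2 + 2 * (a r)\<^sup>2 / r ^ 3) * f r"
definition Q :: "real \<Rightarrow> real" where "Q r = (min (p r) 0)\<^sup>2 + (min (q r) 0)\<^sup>2"

lemma p_deriv: "r > 0 \<Longrightarrow> (p has_real_derivative p' r) (at r)"
  unfolding p'_def by (rule system)

lemma q_deriv: "r > 0 \<Longrightarrow> (q has_real_derivative q' r) (at r)"
  unfolding q_def[abs_def] q'_def using DERIV_minus[OF system(6)] by simp

lemma A_deriv:
  assumes "r > 0"
  shows "(A has_real_derivative - 2 * a r * deriv S r / r\<^sup>2 - 2 * (a r)\<^sup>2 / r ^ 3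
    + 2 * \<kappa>\<^sup>2 * (f r * p r + m r * deriv m r)) (at r)"
proof -
  have r2: "r\<^sup>2 \<noteq> 0" using assms by simp
  have "((\<lambda>r. (a r)\<^sup>2) has_real_derivative - 2 * a r * deriv S r) (at r)"
    using DERIV_power[OF a_deriv[OF assms], of 2] by (simp add: mult_ac)
  moreover have "((\<lambda>r::real. r\<^sup>2) has_real_derivative 2 * r) (at r)"
    using DERIV_power[OF DERIV_ident, of 2 r] by simp
  ultimately have 1: "((\<lambda>r. (a r)\<^sup>2 / r\<^sup>2) has_real_derivative
      (- 2 * a r * deriv S r * r\<^sup>2 - (a r)\<^sup>2 * (2 * r)) / (r\<^sup>2 * r\<^sup>2)) (at r)"
    using r2 by (rule DERIV_divide)
  have 2: "((\<lambda>r. \<kappa>\<^sup>2 * (1 - (f r)\<^sup>2 - (m r)\<^sup>2)) has_real_derivative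
      - (2 * \<kappa>\<^sup>2 * (f r * p r + m r * deriv m r))) (at r)"
    using assms by (auto intro!: derivative_eq_intros system(1,3) simp: algebra_simps)
  have 3: "(- 2 * a r * deriv S r * r\<^sup>2 - (a r)\<^sup>2 * (2 * r)) / (r\<^sup>2 * r\<^sup>2)
      = - 2 * a r * deriv S r / r\<^sup>2 - 2 * (a r)\<^sup>2 / r ^ 3"
    using assms by (simp add: field_simps power2_eq_square power3_eq_cube)
  show ?thesis
    using DERIV_diff[OF 1 2] unfolding A_def[abs_def] 3 by simp
qed

text \<open>By the first equation \<open>r p' = - p + r A f\<close>, and every term on the right is
  differentiable. In \<open>A'\<close> the part with \<open>f f'\<close> completes \<open>A\<close>
  to \<open>A\<^sub>1\<close>, the part with \<open>m m'\<close> gives the coupling to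
  \<open>q\<close>, and the part from \<open>a^2/r^2\<close> gives the source.\<close>

lemma flux_p:
  assumes "r > 0"
  shows "((\<lambda>r. r * p' r) has_real_derivative
    (1 / r + r * A\<^sub>1 r) * p r - (r * B r * q r + r * h r)) (at r)"
proof -
  have "((\<lambda>r. - p r + r * A r * f r) has_real_derivative
     - p' r + (r * (A r * p r) + f r * (A r + r * (- 2 * a r * deriv S r / r\<^sup>2 - 2 * (a r)\<^sup>2 / r ^ 3
       + 2 * \<kappa>\<^sup>2 * (f r * p r + m r * deriv m r))))) (at r)"
    using assms by (auto intro!: derivative_eq_intros system(1,3) p_deriv A_deriv simp: algebra_simps)
  moreover have "- p' r + (r * (A r * p r) + f r * (A r + r * (- 2 * a r * deriv S r / r\<^sup>2 - 2 * (a r)\<^sup>2 / r ^ 3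
       + 2 * \<kappa>\<^sup>2 * (f r * p r + m r * deriv m r)))) = (1 / r + r * A\<^sub>1 r) * p r - (r * B r * q r + r * h r)"
    unfolding p'_def A\<^sub>1_def B_def h_def q_def using assms
    by (simp add: algebra_simps power2_eq_square add_divide_distrib diff_divide_distrib)
  ultimately have *: "((\<lambda>r. - p r + r * A r * f r) has_real_derivative
    (1 / r + r * A\<^sub>1 r) * p r - (r * B r * q r + r * h r)) (at r)" by simp
  show ?thesis
    by (rule has_field_derivative_transform_within_open[OF *, of "{0<..}"])
      (use assms in \<open>auto simp: p'_def field_simps\<close>)
qed

lemma flux_q:
  assumes "r > 0"
  shows "((\<lambda>r. r * q' r) has_real_derivative (1 / r + r * A\<^sub>2 r) * q r - r * B r * p r) (at r)"
proof -
  have "((\<lambda>r. - q r - r * C r * m r) has_real_derivative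
     - q' r - (r * (C r * deriv m r) + m r * (C r + r * (2 * \<kappa>\<^sup>2 * (f r * p r + m r * deriv m r))))) (at r)"
    unfolding C_def[abs_def] using assms
    by (auto intro!: derivative_eq_intros system(1,3) q_deriv
        simp: power2_eq_square field_simps)
  moreover have "- q' r - (r * (C r * deriv m r) + m r * (C r + r * (2 * \<kappa>\<^sup>2 * (f r * p r + m r * deriv m r))))
      = (1 / r + r * A\<^sub>2 r) * q r - r * B r * p r"
    unfolding q'_def A\<^sub>2_def B_def q_def using assms
    by (simp add: algebra_simps power2_eq_square)
  ultimately have *: "((\<lambda>r. - q r - r * C r * m r) has_real_derivative
    (1 / r + r * A\<^sub>2 r) * q r - r * B r * p r) (at r)" by simp
  show ?thesis
    by (rule has_field_derivative_transform_within_open[OF *, of "{0<..}"])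
      (use assms in \<open>auto simp: q'_def field_simps\<close>)
qed

lemma continuous_auxiliary:
  "continuous_on {0<..} q" "continuous_on {0<..} p'" "continuous_on {0<..} q'"
  "continuous_on {0<..} A\<^sub>1" "continuous_on {0<..} A\<^sub>2" "continuous_on {0<..} Q"
proof -
  show q: "continuous_on {0<..} q"
    unfolding q_def[abs_def] by (intro continuous_intros continuous_fields)
  show "continuous_on {0<..} p'" "continuous_on {0<..} q'"
    unfolding p'_def[abs_def] q'_def[abs_def]
    by (intro continuous_intros continuous_fields continuous_coefficients q; simp)+
  show "continuous_on {0<..} A\<^sub>1" "continuous_on {0<..} A\<^sub>2"
    unfolding A\<^sub>1_def[abs_def] A\<^sub>2_def[abs_def] by (intro continuous_intros continuous_fields continuous_coefficients)+
  show "continuous_on {0<..} Q"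
    unfolding Q_def[abs_def] by (intro continuous_intros continuous_fields q)
qed

lemma B_nonneg: "r > 0 \<Longrightarrow> 0 \<le> B r"
  unfolding B_def using f_nonneg[of r] m_nonneg[of r] by simp

lemma h_pos: "r > 0 \<Longrightarrow> 0 < h r"
  unfolding h_def using a_S_nonneg[of r] a_nonzero[of r] f_pos[of r]
  by (intro mult_pos_pos add_nonneg_pos) auto

text \<open>Nothing is known about \<open>x\<close> at nonpositive arguments, but \<eta> vanishes to
  the left of \<open>lo > 0\<close>. The product is therefore C1 on the whole line, as the
  membership lemmas for X and H require.\<close>

lemma truncation_C1:
  assumes \<eta>: "\<And>r. (\<eta> has_real_derivative \<eta>' r) (at r)" "continuous_on UNIV \<eta>'"
    "\<And>r. r \<notin> {lo..hi} \<Longrightarrow> \<eta> r = 0" and "0 < lo"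
    and x: "\<And>r. r > 0 \<Longrightarrow> (x has_real_derivative x' r) (at r)" "continuous_on {0<..} x'"
    and "\<delta> > 0"
  shows "((\<lambda>r. \<eta> r * smooth_neg \<delta> (x r)) has_real_derivative
      \<eta>' r * smooth_neg \<delta> (x r) + \<eta> r * smooth_neg' \<delta> (x r) * x' r) (at r)"
    and "continuous_on UNIV (\<lambda>r. \<eta>' r * smooth_neg \<delta> (x r) + \<eta> r * smooth_neg' \<delta> (x r) * x' r)"
    and "r \<notin> {lo..hi} \<Longrightarrow> \<eta> r * smooth_neg \<delta> (x r) = 0"
proof -
  have \<eta>'0: "\<eta>' r = 0" if "r \<notin> {lo..hi}" for r
    using derivative_zero_off_interval[OF \<eta>(1,3) that] .
  show "((\<lambda>r. \<eta> r * smooth_neg \<delta> (x r)) has_real_derivative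
      \<eta>' r * smooth_neg \<delta> (x r) + \<eta> r * smooth_neg' \<delta> (x r) * x' r) (at r)"
  proof (cases "r > 0")
    case True
    have "((\<lambda>r. smooth_neg \<delta> (x r)) has_real_derivative smooth_neg' \<delta> (x r) * x' r) (at r)"
      by (rule DERIV_chain2[OF smooth_neg_deriv(1)[OF \<open>\<delta> > 0\<close>] x(1)[OF True]])
    from DERIV_mult[OF \<eta>(1) this] show ?thesis by (simp add: algebra_simps)
  next
    case False
    have "((\<lambda>_. 0) has_real_derivative 0) (at r)" by simp
    then have "((\<lambda>r. \<eta> r * smooth_neg \<delta> (x r)) has_real_derivative 0) (at r)"
      by (rule has_field_derivative_transform_within_open[of _ _ _ "{..<lo}"])
        (use False \<open>0 < lo\<close> \<eta>(3) in auto)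
    moreover have "\<eta> r = 0" "\<eta>' r = 0" using False \<open>0 < lo\<close> \<eta>(3) \<eta>'0 by auto
    ultimately show ?thesis by simp
  qed
  have contx: "continuous_on {0<..} x" using x(1) by (intro continuous_on_real_derivative) auto
  have continuous_fields\<eta>: "continuous_on {0<..} \<eta>" "continuous_on {0<..} \<eta>'"
    using continuous_on_real_derivative[OF \<eta>(1)] \<eta>(2) by (auto intro: continuous_on_subset)
  have cs: "continuous_on UNIV (smooth_neg \<delta>)" "continuous_on UNIV (smooth_neg' \<delta>)"
    using smooth_neg_deriv[OF \<open>\<delta> > 0\<close>] by (auto intro: continuous_on_real_derivative)
  show "continuous_on UNIV (\<lambda>r. \<eta>' r * smooth_neg \<delta> (x r) + \<eta> r * smooth_neg' \<delta> (x r) * x' r)"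
  proof (rule continuous_on_UNIV_zero_extension[OF _ \<open>0 < lo\<close>])
    show "continuous_on {0<..} (\<lambda>r. \<eta>' r * smooth_neg \<delta> (x r) + \<eta> r * smooth_neg' \<delta> (x r) * x' r)"
      by (intro continuous_intros continuous_fields\<eta> x(2) continuous_on_compose2[OF cs(1) contx]
          continuous_on_compose2[OF cs(2) contx]) auto
  qed (use \<eta>(3) \<eta>'0 in auto)
  show "r \<notin> {lo..hi} \<Longrightarrow> \<eta> r * smooth_neg \<delta> (x r) = 0" using \<eta>(3) by simp
qed

end

section \<open>The second variation at the truncated derivatives\<close>

context GL_solution
begin

text \<open>Pointwise version of testing the equations for \<open>p\<close> and \<open>q\<close>. On
  the right, the first two summands form a total derivative, the third is the density that survives,
  and \<delta> multiplies a quantity free of \<delta>. The minus sign in \<open>w\<close> turns the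
  mixed term \<open>4 \<kappa>^2 f m u w\<close> into \<open>- 2 B \<eta>^2 P Z\<close>, which
  absorbs the coupling of the two equations.\<close>

lemma second_variation_density_estimate:
  fixes \<eta> \<eta>' \<delta> r :: real
  assumes "r > 0" and \<delta>: "0 < \<delta>" "\<delta> \<le> 1"
  defines "P \<equiv> smooth_neg \<delta> (p r)" and "P' \<equiv> smooth_neg' \<delta> (p r)" and "P'' \<equiv> smooth_neg'' \<delta> (p r)"
    and "Z \<equiv> smooth_neg \<delta> (q r)" and "Z' \<equiv> smooth_neg' \<delta> (q r)" and "Z'' \<equiv> smooth_neg'' \<delta> (q r)"
  defines "u \<equiv> \<eta> * P" and "w \<equiv> - (\<eta> * Z)"
    and "u' \<equiv> \<eta>' * P + \<eta> * P' * p' r" and "w' \<equiv> - (\<eta>' * Z + \<eta> * Z' * q' r)"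
  shows "(u'\<^sup>2 + w'\<^sup>2 + (of_int d - S r)\<^sup>2 / r\<^sup>2 * u\<^sup>2 + \<kappa>\<^sup>2 * g * w\<^sup>2
       - \<kappa>\<^sup>2 * (1 - (f r)\<^sup>2 - (m r)\<^sup>2) * (u\<^sup>2 + w\<^sup>2) + 2 * \<kappa>\<^sup>2 * (f r * u + m r * w)\<^sup>2) * r
    \<le> (((1 / r + r * A\<^sub>1 r) * p r - (r * B r * q r + r * h r)) * (\<eta>\<^sup>2 * P * P')
        + r * p' r * (2 * \<eta> * \<eta>' * P * P' + \<eta>\<^sup>2 * (P'\<^sup>2 + P * P'') * p' r))
      + (((1 / r + r * A\<^sub>2 r) * q r - r * B r * p r) * (\<eta>\<^sup>2 * Z * Z')
        + r * q' r * (2 * \<eta> * \<eta>' * Z * Z' + \<eta>\<^sup>2 * (Z'\<^sup>2 + Z * Z'') * q' r))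
      + (r * \<eta>'\<^sup>2 * Q r - \<eta>\<^sup>2 * Q r / r)
      + \<delta> * (r * \<eta>'\<^sup>2 * (\<bar>p r\<bar> + \<bar>q r\<bar> + 2)
        + \<eta>\<^sup>2 * ((r * \<bar>A\<^sub>1 r\<bar> + 1 / r) * (\<bar>p r\<bar> + 1) + (r * \<bar>A\<^sub>2 r\<bar> + 1 / r) * (\<bar>q r\<bar> + 1)))"
    (is "?E \<le> ?Fp + ?Fq + ?G + \<delta> * ?c")
proof -
  note bP = smooth_neg_bounds[OF \<delta>(1), of "p r", folded P_def P'_def P''_def]
  note bZ = smooth_neg_bounds[OF \<delta>(1), of "q r", folded Z_def Z'_def Z''_def]
  note sP = smooth_neg_square_le[OF \<delta>, of "p r", folded P_def]
  note sZ = smooth_neg_square_le[OF \<delta>, of "q r", folded Z_def]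
  have P0: "P \<le> 0" "P \<le> p r" and Z0: "Z \<le> 0" "Z \<le> q r" using bP(1) bZ(1) by auto
  have "?E = ((\<eta>' * P + \<eta> * P' * p' r)\<^sup>2 + A\<^sub>1 r * (\<eta> * P)\<^sup>2) * r
      + ((\<eta>' * Z + \<eta> * Z' * q' r)\<^sup>2 + A\<^sub>2 r * (\<eta> * Z)\<^sup>2) * r - r * B r * \<eta>\<^sup>2 * (2 * (P * Z))"
    unfolding u_def w_def u'_def w'_def power2_minus
    by (simp add: A\<^sub>1_def A\<^sub>2_def A_def C_def a_def B_def power2_eq_square algebra_simps)
  moreover have "((\<eta>' * P + \<eta> * P' * p' r)\<^sup>2 + A\<^sub>1 r * (\<eta> * P)\<^sup>2) * r
      \<le> ?Fp + (r * B r * q r + r * h r) * (\<eta>\<^sup>2 * P * P') + r * \<eta>'\<^sup>2 * P\<^sup>2 - \<eta>\<^sup>2 * P\<^sup>2 / r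
        + \<eta>\<^sup>2 * (\<delta> / 2) * (r * \<bar>A\<^sub>1 r\<bar> + 1 / r) * (- P)"
    by (rule truncated_component_estimate[OF assms(1) P0(1) bP(5-7)])
  moreover have "((\<eta>' * Z + \<eta> * Z' * q' r)\<^sup>2 + A\<^sub>2 r * (\<eta> * Z)\<^sup>2) * r
      \<le> ?Fq + (r * B r * p r) * (\<eta>\<^sup>2 * Z * Z') + r * \<eta>'\<^sup>2 * Z\<^sup>2 - \<eta>\<^sup>2 * Z\<^sup>2 / r
        + \<eta>\<^sup>2 * (\<delta> / 2) * (r * \<bar>A\<^sub>2 r\<bar> + 1 / r) * (- Z)"
    by (rule truncated_component_estimate[OF assms(1) Z0(1) bZ(5-7)])
  moreover have "(r * B r * q r + r * h r) * (\<eta>\<^sup>2 * P * P') + (r * B r * p r) * (\<eta>\<^sup>2 * Z * Z')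
      \<le> r * B r * \<eta>\<^sup>2 * (2 * (P * Z))"
  proof -
    have "r * B r * \<eta>\<^sup>2 * (q r * (P * P') + p r * (Z * Z')) \<le> r * B r * \<eta>\<^sup>2 * (2 * (P * Z))"
      using assms(1) B_nonneg P0 Z0 bP bZ
      by (intro mult_left_mono cooperative_bound mult_nonneg_nonneg) auto
    \<comment> \<open>The source has the favourable sign: it is positive and meets the nonpositive
      factor \<open>P\<close>.\<close>
    moreover have "(r * h r * \<eta>\<^sup>2 * P') * P \<le> 0"
      using assms(1) h_pos[OF assms(1)] P0 bP(3) by (intro mult_nonneg_nonpos) auto
    ultimately show ?thesis by (simp add: algebra_simps)
  qed
  moreover have "r * \<eta>'\<^sup>2 * P\<^sup>2 + r * \<eta>'\<^sup>2 * Z\<^sup>2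
      \<le> r * \<eta>'\<^sup>2 * Q r + \<delta> * (r * \<eta>'\<^sup>2 * (\<bar>p r\<bar> + \<bar>q r\<bar> + 2))"
  proof -
    have "r * \<eta>'\<^sup>2 * (P\<^sup>2 + Z\<^sup>2) \<le> r * \<eta>'\<^sup>2 * (Q r + \<delta> * (\<bar>p r\<bar> + \<bar>q r\<bar> + 2))"
      using sP(1) sZ(1) assms(1) by (intro mult_left_mono) (auto simp: Q_def algebra_simps)
    then show ?thesis by (simp add: algebra_simps)
  qed
  moreover have "\<eta>\<^sup>2 * Q r / r \<le> \<eta>\<^sup>2 * P\<^sup>2 / r + \<eta>\<^sup>2 * Z\<^sup>2 / r"
  proof -
    have "\<eta>\<^sup>2 * Q r / r \<le> \<eta>\<^sup>2 * (P\<^sup>2 + Z\<^sup>2) / r"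
      using sP(2) sZ(2) assms(1) by (intro divide_right_mono mult_left_mono) (auto simp: Q_def)
    then show ?thesis by (simp add: algebra_simps add_divide_distrib)
  qed
  moreover have err: "\<eta>\<^sup>2 * (\<delta> / 2) * (r * \<bar>\<alpha>\<bar> + 1 / r) * (- X) \<le> \<delta> * (\<eta>\<^sup>2 * ((r * \<bar>\<alpha>\<bar> + 1 / r) * (\<bar>x\<bar> + 1)))"
    if "- X \<le> \<bar>x\<bar> + 1" for X x \<alpha> :: real
  proof -
    have "\<eta>\<^sup>2 * (\<delta> / 2) * (r * \<bar>\<alpha>\<bar> + 1 / r) * (- X) \<le> \<eta>\<^sup>2 * \<delta> * (r * \<bar>\<alpha>\<bar> + 1 / r) * (\<bar>x\<bar> + 1)"
      using that \<delta> assms(1)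
      by (intro order_trans[OF mult_left_mono[OF that] mult_right_mono] mult_right_mono mult_left_mono
          mult_nonneg_nonneg) auto
    then show ?thesis by (simp add: mult_ac)
  qed
  moreover have "\<delta> * ?c = \<delta> * (r * \<eta>'\<^sup>2 * (\<bar>p r\<bar> + \<bar>q r\<bar> + 2))
      + \<delta> * (\<eta>\<^sup>2 * ((r * \<bar>A\<^sub>1 r\<bar> + 1 / r) * (\<bar>p r\<bar> + 1)))
      + \<delta> * (\<eta>\<^sup>2 * ((r * \<bar>A\<^sub>2 r\<bar> + 1 / r) * (\<bar>q r\<bar> + 1)))"
    by (simp add: algebra_simps)
  moreover note err[OF sP(3), of "A\<^sub>1 r"] err[OF sZ(3), of "A\<^sub>2 r"]
  ultimately show ?thesis by linarith
qed

end

locale stable_GL_solution = GL_solution +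
  assumes stable: "\<And>u v w. u \<in> X_space \<Longrightarrow> v \<in> X_space \<Longrightarrow> w \<in> H_space \<Longrightarrow>
    second_variation \<kappa> g d f S m u v w \<ge> 0"
begin

text \<open>Stability bounds the integrated second variation from below by 0, and the density
  estimate bounds it from above. After the total derivative drops out, the limit \<delta> to 0 is
  taken on the fixed interval, where the error is \<delta> times a finite constant.\<close>

lemma stability_test:
  fixes \<eta> \<eta>' :: "real \<Rightarrow> real"
  assumes \<eta>: "\<And>r. (\<eta> has_real_derivative \<eta>' r) (at r)" "continuous_on UNIV \<eta>'"
    "\<And>r. r \<notin> {lo<..<hi} \<Longrightarrow> \<eta> r = 0" and lo: "0 < lo" "lo \<le> hi"
  shows "0 \<le> integral {lo..hi} (\<lambda>r. r * (\<eta>' r)\<^sup>2 * Q r - (\<eta> r)\<^sup>2 * Q r / r)"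
    (is "0 \<le> integral _ ?G")
proof -
  have supp: "\<eta> r = 0" if "r \<notin> {lo..hi}" for r using \<eta>(3) that by auto
  define c where "c r = r * (\<eta>' r)\<^sup>2 * (\<bar>p r\<bar> + \<bar>q r\<bar> + 2)
    + (\<eta> r)\<^sup>2 * ((r * \<bar>A\<^sub>1 r\<bar> + 1 / r) * (\<bar>p r\<bar> + 1) + (r * \<bar>A\<^sub>2 r\<bar> + 1 / r) * (\<bar>q r\<bar> + 1))" for r
  have sub: "{lo..hi} \<subseteq> {0<..}" using lo by auto
  have continuous_fields\<eta>: "continuous_on {lo..hi} \<eta>" "continuous_on {lo..hi} \<eta>'"
    using continuous_on_real_derivative[OF \<eta>(1)] \<eta>(2) by (auto intro: continuous_on_subset)
  note conts = continuous_fields\<eta> continuous_auxiliary[THEN continuous_on_subset, OF sub] continuous_fields[THEN continuous_on_subset, OF sub]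
  have ci: "c integrable_on {lo..hi}"
    unfolding c_def[abs_def] using lo by (intro integrable_continuous_interval continuous_intros conts) auto
  have Gi: "?G integrable_on {lo..hi}"
    using lo by (intro integrable_continuous_interval continuous_intros conts) auto
  have "0 \<le> integral {lo..hi} ?G + \<delta> * integral {lo..hi} c" if \<delta>: "0 < \<delta>" "\<delta> \<le> 1" for \<delta>
  proof -
    define u where "u r = \<eta> r * smooth_neg \<delta> (p r)" for r
    define u' where "u' r = \<eta>' r * smooth_neg \<delta> (p r) + \<eta> r * smooth_neg' \<delta> (p r) * p' r" for r
    define w where "w r = - (\<eta> r * smooth_neg \<delta> (q r))" for r
    define w' where "w' r = - (\<eta>' r * smooth_neg \<delta> (q r) + \<eta> r * smooth_neg' \<delta> (q r) * q' r)" for r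
    note tp = truncation_C1[of \<eta> \<eta>' lo hi p p' \<delta>, OF \<eta>(1,2) _ lo(1) _ continuous_auxiliary(2) \<delta>(1)]
    note tq = truncation_C1[of \<eta> \<eta>' lo hi q q' \<delta>, OF \<eta>(1,2) _ lo(1) _ continuous_auxiliary(3) \<delta>(1)]
    have u: "(u has_real_derivative u' r) (at r)" "continuous_on UNIV u'" for r
      unfolding u_def[abs_def] u'_def[abs_def] by (rule tp(1,2); erule supp p_deriv)+
    have w: "(w has_real_derivative w' r) (at r)" "continuous_on UNIV w'" for r
      unfolding w_def[abs_def] w'_def[abs_def]
      by (rule DERIV_minus, rule tq(1); erule supp q_deriv)
        (rule continuous_on_minus, rule tq(2); erule supp q_deriv)
    have uw0: "u r = 0" "w r = 0" if "r \<notin> {lo..hi}" for r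
      using supp[OF that] by (simp_all add: u_def w_def)
    let ?E = "\<lambda>r. ((u' r)\<^sup>2 + (w' r)\<^sup>2 + (of_int d - S r)\<^sup>2 / r\<^sup>2 * (u r)\<^sup>2 + \<kappa>\<^sup>2 * g * (w r)\<^sup>2
       - \<kappa>\<^sup>2 * (1 - (f r)\<^sup>2 - (m r)\<^sup>2) * ((u r)\<^sup>2 + (w r)\<^sup>2)
       + 2 * \<kappa>\<^sup>2 * (f r * u r + m r * w r)\<^sup>2) * r"
    have "0 \<le> second_variation \<kappa> g d f S m u (\<lambda>_. 0) w"
    proof (rule stable)
      show "u \<in> X_space" by (rule radial_C1_in_X_space[OF u _ lo(1)]) (rule uw0)
      show "(\<lambda>_. 0) \<in> X_space"
        by (rule radial_C1_in_X_space[of _ "\<lambda>_. 0" lo hi]) (use lo in auto)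
      show "w \<in> H_space" by (rule radial_C1_in_H_space[OF w _ lo(1)]) (rule uw0)
    qed
    also have "second_variation \<kappa> g d f S m u (\<lambda>_. 0) w = integral {lo..hi} ?E"
      by (rule second_variation_C1[OF u _ w _ lo(1) continuous_fields(1-3)]; erule uw0)
    finally have E0: "0 \<le> integral {lo..hi} ?E" .
    have contuw: "continuous_on {lo..hi} u" "continuous_on {lo..hi} w"
      "continuous_on {lo..hi} u'" "continuous_on {lo..hi} w'"
      using continuous_on_real_derivative[OF u(1)] continuous_on_real_derivative[OF w(1)] u(2) w(2)
      by (auto intro: continuous_on_subset)
    have Ei: "?E integrable_on {lo..hi}"
      using lo by (intro integrable_continuous_interval continuous_intros conts contuw) auto
    \<comment> \<open>Each flux is paired with \<open>\<eta>^2 \<Phi>(x) \<Phi>'(x)\<close>, the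
      derivative of \<open>(\<eta> \<Phi>(x))^2 / 2\<close> with respect to
      \<open>x\<close>.\<close>
    define F where "F r = r * p' r * ((\<eta> r)\<^sup>2 * smooth_neg \<delta> (p r) * smooth_neg' \<delta> (p r))
      + r * q' r * ((\<eta> r)\<^sup>2 * smooth_neg \<delta> (q r) * smooth_neg' \<delta> (q r))" for r
    define dF where "dF r =
      (((1 / r + r * A\<^sub>1 r) * p r - (r * B r * q r + r * h r)) * ((\<eta> r)\<^sup>2 * smooth_neg \<delta> (p r) * smooth_neg' \<delta> (p r))
        + r * p' r * (2 * \<eta> r * \<eta>' r * smooth_neg \<delta> (p r) * smooth_neg' \<delta> (p r)
          + (\<eta> r)\<^sup>2 * ((smooth_neg' \<delta> (p r))\<^sup>2 + smooth_neg \<delta> (p r) * smooth_neg'' \<delta> (p r)) * p' r))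
      + (((1 / r + r * A\<^sub>2 r) * q r - r * B r * p r) * ((\<eta> r)\<^sup>2 * smooth_neg \<delta> (q r) * smooth_neg' \<delta> (q r))
        + r * q' r * (2 * \<eta> r * \<eta>' r * smooth_neg \<delta> (q r) * smooth_neg' \<delta> (q r)
          + (\<eta> r)\<^sup>2 * ((smooth_neg' \<delta> (q r))\<^sup>2 + smooth_neg \<delta> (q r) * smooth_neg'' \<delta> (q r)) * q' r))" for r
    have F_deriv: "(F has_real_derivative dF r) (at r)" if "r > 0" for r
    proof -
      have cutoff: "((\<lambda>r. (\<eta> r)\<^sup>2 * smooth_neg \<delta> (x r) * smooth_neg' \<delta> (x r)) has_real_derivative
        2 * \<eta> r * \<eta>' r * smooth_neg \<delta> (x r) * smooth_neg' \<delta> (x r)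
        + (\<eta> r)\<^sup>2 * ((smooth_neg' \<delta> (x r))\<^sup>2 + smooth_neg \<delta> (x r) * smooth_neg'' \<delta> (x r)) * x' r) (at r)"
        if x: "(x has_real_derivative x' r) (at r)" for x x' :: "real \<Rightarrow> real"
        using \<eta>(1)[of r] DERIV_chain2[OF smooth_neg_deriv(1)[OF \<delta>(1)] x]
          DERIV_chain2[OF smooth_neg_deriv(2)[OF \<delta>(1)] x]
        by (auto intro!: derivative_eq_intros simp: algebra_simps power2_eq_square)
      show ?thesis
        unfolding F_def[abs_def] dF_def
        using DERIV_add[OF DERIV_mult[OF flux_p[OF that] cutoff[of p p', OF p_deriv[OF that]]]
          DERIV_mult[OF flux_q[OF that] cutoff[of q q', OF q_deriv[OF that]]]]
        by (simp only: mult.commute add.commute)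
    qed
    have "(dF has_integral F hi - F lo) {lo..hi}"
      using lo F_deriv by (intro fundamental_theorem_of_calculus)
        (auto simp: has_real_derivative_iff_has_vector_derivative[symmetric]
          intro: has_field_derivative_at_within)
    \<comment> \<open>The support condition on \<eta> uses the open interval, so \<eta> vanishes at
      both endpoints as well.\<close>
    moreover have "F hi = 0" "F lo = 0" using \<eta>(3) by (auto simp: F_def)
    ultimately have dF0: "(dF has_integral 0) {lo..hi}" by simp
    have "integral {lo..hi} ?E \<le> 0 + integral {lo..hi} ?G + \<delta> * integral {lo..hi} c"
    proof (rule has_integral_le[OF integrable_integral[OF Ei]])
      show "((\<lambda>r. dF r + ?G r + \<delta> * c r) has_integral 0 + integral {lo..hi} ?G + \<delta> * integral {lo..hi} c) {lo..hi}"
        by (intro has_integral_add dF0 integrable_integral Gi has_integral_mult_right ci)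
      show "?E r \<le> dF r + ?G r + \<delta> * c r" if "r \<in> {lo..hi}" for r
        unfolding u_def w_def u'_def w'_def dF_def c_def
        by (rule second_variation_density_estimate) (use that lo \<delta> in auto)
    qed
    then show ?thesis using E0 by linarith
  qed
  then show ?thesis by (rule nonneg_if_nonneg_perturbed)
qed

end

section \<open>Removal of the cutoff\<close>

definition base :: "real \<Rightarrow> real" where "base r = r / (1 + r)"
text \<open>The square of the window is \<open>C\<^sup>1\<close> on \<open>(0,\<infinity>)\<close> and is supported in \<open>[1/N, N]\<close>.\<close>

definition window :: "real \<Rightarrow> real \<Rightarrow> real" where
  "window N r = max 0 ((1 - 1 / (N * r)) * (1 - r / N))"
definition cutoff :: "real \<Rightarrow> real \<Rightarrow> real" where
  "cutoff N r = (if r \<le> 0 then 0 else base r * (window N r)\<^sup>2)"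
definition cutoff' :: "real \<Rightarrow> real \<Rightarrow> real" where
  "cutoff' N r = (if r \<le> 0 then 0 else
     (window N r)\<^sup>2 / (1 + r)\<^sup>2 + base r * (2 * window N r * (1 / (N * r\<^sup>2) - 1 / N)))"

lemma window_eq_0:
  assumes "N \<ge> 1" and "r > 0" and "r \<notin> {1 / N<..<N}"
  shows "window N r = 0"
proof -
  have "1 / N \<le> 1" using assms(1) by simp
  then have "1 / N \<le> N" using assms(1) by linarith
  then consider "r \<le> 1 / N" "r \<le> N" | "N \<le> r" "1 / N \<le> r" using assms(3) by force
  then have "(1 - 1 / (N * r)) * (1 - r / N) \<le> 0"
  proof cases
    case 1
    have "N * r \<le> N * (1 / N)" using 1(1) assms(1) by (intro mult_left_mono) auto
    then have "N * r \<le> 1" using assms(1) by simp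
    then have "1 - 1 / (N * r) \<le> 0" using assms by simp
    moreover have "0 \<le> 1 - r / N" using 1(2) assms(1) by simp
    ultimately show ?thesis by (rule mult_nonpos_nonneg)
  next
    case 2
    have "N * (1 / N) \<le> N * r" using 2(2) assms(1) by (intro mult_left_mono) auto
    then have "1 \<le> N * r" using assms(1) by simp
    then have "0 \<le> 1 - 1 / (N * r)" by simp
    moreover have "1 - r / N \<le> 0" using 2(1) assms(1) by simp
    ultimately show ?thesis by (rule mult_nonneg_nonpos)
  qed
  then show ?thesis by (simp add: window_def)
qed

lemma window_bounds:
  assumes "N \<ge> 1" and "r > 0"
  shows "0 \<le> window N r" "window N r \<le> 1"
proof -
  show "0 \<le> window N r" by (simp add: window_def)
  show "window N r \<le> 1"
  proof (cases "r \<in> {1 / N<..<N}")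
    case True
    then have "N * (1 / N) \<le> N * r" using assms(1) by (intro mult_left_mono) auto
    then have "1 \<le> N * r" using assms(1) by simp
    then have "0 \<le> 1 - 1 / (N * r)" "1 - 1 / (N * r) \<le> 1" by simp_all
    moreover have "0 \<le> 1 - r / N" "1 - r / N \<le> 1" using True assms by simp_all
    ultimately have "(1 - 1 / (N * r)) * (1 - r / N) \<le> 1" by (intro mult_le_one) auto
    then show ?thesis by (simp add: window_def)
  qed (simp add: window_eq_0[OF assms])
qed

text \<open>Uniformity in \<open>N\<close> is what dominated convergence needs. Inside the window
  \<open>N r > 1\<close>, so \<open>base r / (N r^2) \<le> 1 / (N r) \<le> 1\<close>: the steep
  inner edge is compensated by the linear vanishing of \<open>base\<close>. The slope is thus at
  most 1 + 2, whence 9.\<close>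

lemma cutoff_bounds:
  assumes "N \<ge> 1" and "r > 0"
  shows "(cutoff N r)\<^sup>2 \<le> r\<^sup>2" "(cutoff' N r)\<^sup>2 \<le> 9"
proof -
  note w = window_bounds[OF assms]
  have b: "0 \<le> base r" "base r \<le> r" "base r \<le> 1"
    unfolding base_def using assms(2) by (simp_all add: pos_divide_le_eq distrib_left)
  have w2: "(window N r)\<^sup>2 \<le> 1" using w by (simp add: power_le_one)
  have "base r * (window N r)\<^sup>2 \<le> r * 1" using b w2 by (intro mult_mono) auto
  then show "(cutoff N r)\<^sup>2 \<le> r\<^sup>2"
    using assms(2) b by (auto simp: cutoff_def intro!: power_mono)
  have 1: "0 \<le> (window N r)\<^sup>2 / (1 + r)\<^sup>2" "(window N r)\<^sup>2 / (1 + r)\<^sup>2 \<le> 1"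
  proof -
    have "1 \<le> (1 + r)\<^sup>2" using assms(2) by simp
    then show "(window N r)\<^sup>2 / (1 + r)\<^sup>2 \<le> 1" using w2 by (simp add: divide_le_eq_1)
  qed simp
  have 2: "\<bar>base r * (2 * window N r * (1 / (N * r\<^sup>2) - 1 / N))\<bar> \<le> 2"
  proof (cases "r \<in> {1 / N<..<N}")
    case True
    have "base r * (1 / (N * r\<^sup>2)) \<le> r * (1 / (N * r\<^sup>2))"
      using b assms by (intro mult_right_mono) auto
    also have "\<dots> \<le> 1" using True assms by (simp add: power2_eq_square field_simps)
    finally have "base r * (1 / (N * r\<^sup>2)) \<le> 1" .
    moreover have "base r * (1 / N) \<le> 1 * 1" using b assms by (intro mult_mono) auto
    moreover have "0 \<le> base r * (1 / (N * r\<^sup>2))" "0 \<le> base r * (1 / N)" using b assms by auto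
    ultimately have "\<bar>base r * (1 / (N * r\<^sup>2) - 1 / N)\<bar> \<le> 1"
      unfolding right_diff_distrib by linarith
    then have "\<bar>window N r\<bar> * \<bar>base r * (1 / (N * r\<^sup>2) - 1 / N)\<bar> \<le> 1 * 1"
      using w by (intro mult_mono) auto
    moreover have "base r * (2 * window N r * (1 / (N * r\<^sup>2) - 1 / N))
        = 2 * (window N r * (base r * (1 / (N * r\<^sup>2) - 1 / N)))"
      by (simp only: mult_ac)
    ultimately show ?thesis by (simp only: abs_mult abs_numeral)
  qed (simp add: window_eq_0[OF assms])
  have "cutoff' N r = (window N r)\<^sup>2 / (1 + r)\<^sup>2
      + base r * (2 * window N r * (1 / (N * r\<^sup>2) - 1 / N))"
    using assms(2) by (simp add: cutoff'_def)
  then have "\<bar>cutoff' N r\<bar> \<le> 3" using 1 2 by linarith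
  then have "(cutoff' N r)\<^sup>2 \<le> 3\<^sup>2" by (metis abs_ge_zero power2_abs power_mono)
  then show "(cutoff' N r)\<^sup>2 \<le> 9" by simp
qed

lemma cutoff_eq_0:
  assumes "N \<ge> 1" and "r \<notin> {1 / N<..<N}"
  shows "cutoff N r = 0"
  using window_eq_0[OF assms(1) _ assms(2)] by (simp add: cutoff_def)

lemma continuous_on_window: "N \<ge> 1 \<Longrightarrow> continuous_on {0<..} (window N)"
  unfolding window_def[abs_def] by (intro continuous_intros) auto

lemma cutoff_C1:
  assumes "N \<ge> 1"
  shows "(cutoff N has_real_derivative cutoff' N r) (at r)" "continuous_on UNIV (cutoff' N)"
proof -
  show "(cutoff N has_real_derivative cutoff' N r) (at r)"
  proof (cases "r > 0")
    case True
    have k: "((\<lambda>r. (1 - 1 / (N * r)) * (1 - r / N)) has_real_derivative 1 / (N * r\<^sup>2) - 1 / N) (at r)"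
      using True assms by (auto intro!: derivative_eq_intros simp: field_simps power2_eq_square)
    have "((\<lambda>r. (window N r)\<^sup>2) has_real_derivative 2 * window N r * (1 / (N * r\<^sup>2) - 1 / N)) (at r)"
      unfolding window_def[abs_def] by (rule DERIV_chain2[OF has_real_derivative_pos_part_square k])
    moreover have "(base has_real_derivative 1 / (1 + r)\<^sup>2) (at r)"
      unfolding base_def[abs_def] using True
      by (auto intro!: derivative_eq_intros simp: field_simps power2_eq_square)
    ultimately have "((\<lambda>r. base r * (window N r)\<^sup>2) has_real_derivative cutoff' N r) (at r)"
      by (rule DERIV_cong[OF DERIV_mult[rotated]]) (use True in \<open>simp add: cutoff'_def mult.commute\<close>)
    then show ?thesis
      by (rule has_field_derivative_transform_within_open[of _ _ _ "{0<..}"])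
        (use True in \<open>auto simp: cutoff_def\<close>)
  next
    case False
    have "((\<lambda>_. 0) has_real_derivative cutoff' N r) (at r)" using False by (simp add: cutoff'_def)
    then show ?thesis
      by (rule has_field_derivative_transform_within_open[of _ _ _ "{..<1 / N}"])
        (use False assms cutoff_eq_0[OF assms] in \<open>auto simp: le_less_trans[of _ 0]\<close>)
  qed
  show "continuous_on UNIV (cutoff' N)"
  proof (rule continuous_on_UNIV_zero_extension[of _ "1 / N"])
    have "continuous_on {0<..} (\<lambda>r. (window N r)\<^sup>2 / (1 + r)\<^sup>2
        + base r * (2 * window N r * (1 / (N * r\<^sup>2) - 1 / N)))"
      unfolding base_def[abs_def] using assms
      by (intro continuous_intros continuous_on_window[OF assms]) auto
    then show "continuous_on {0<..} (cutoff' N)"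
      by (rule continuous_on_eq) (simp add: cutoff'_def)
    show "0 < 1 / N" using assms by simp
    show "cutoff' N r = 0" if "r < 1 / N" for r
      using window_eq_0[OF assms, of r] that by (auto simp: cutoff'_def)
  qed
qed

lemma cutoff_tendsto:
  assumes "r > 0"
  shows "(\<lambda>n. cutoff (real (Suc n)) r) \<longlonglongrightarrow> base r"
    "(\<lambda>n. cutoff' (real (Suc n)) r) \<longlonglongrightarrow> 1 / (1 + r)\<^sup>2"
proof -
  have inv: "(\<lambda>n. 1 / real (Suc n)) \<longlonglongrightarrow> 0"
    using lim_inverse_n'[THEN LIMSEQ_Suc] by (simp only: of_nat_Suc)
  have "(\<lambda>n. max 0 ((1 - 1 / real (Suc n) * (1 / r)) * (1 - r * (1 / real (Suc n)))))
      \<longlonglongrightarrow> max 0 ((1 - 0 * (1 / r)) * (1 - r * 0))"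
    by (intro tendsto_intros inv)
  then have w: "(\<lambda>n. window (real (Suc n)) r) \<longlonglongrightarrow> 1"
    unfolding window_def by (simp add: mult.commute)
  have "(\<lambda>n. base r * (window (real (Suc n)) r)\<^sup>2) \<longlonglongrightarrow> base r * 1\<^sup>2"
    by (intro tendsto_intros w)
  then show "(\<lambda>n. cutoff (real (Suc n)) r) \<longlonglongrightarrow> base r"
    using assms by (simp add: cutoff_def)
  have "(\<lambda>n. (window (real (Suc n)) r)\<^sup>2 / (1 + r)\<^sup>2 + base r * (2 * window (real (Suc n)) r *
      (1 / real (Suc n) * (1 / r\<^sup>2) - 1 / real (Suc n)))) \<longlonglongrightarrow>
      1\<^sup>2 / (1 + r)\<^sup>2 + base r * (2 * 1 * (0 * (1 / r\<^sup>2) - 0))"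
    using assms by (intro tendsto_intros w inv) auto
  then show "(\<lambda>n. cutoff' (real (Suc n)) r) \<longlonglongrightarrow> 1 / (1 + r)\<^sup>2"
    using assms by (simp add: cutoff'_def)
qed

text \<open>At a zero the minimum forces \<open>x' = 0\<close>, so a decreasing flux turns negative
  to the right and drags \<open>x\<close> below 0. The sign of \<open>D\<close> is asked for only at
  a zero of \<open>x\<close>, where the zeroth-order term of the equation disappears.\<close>

lemma positive_if_flux_decreasing:
  fixes x x' :: "real \<Rightarrow> real"
  assumes x: "\<And>r. r > 0 \<Longrightarrow> (x has_real_derivative x' r) (at r)" and nonneg: "\<And>r. r > 0 \<Longrightarrow> x r \<ge> 0"
    and "r > 0" and flux: "((\<lambda>r. r * x' r) has_real_derivative D) (at r)" and D: "x r = 0 \<Longrightarrow> D < 0"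
  shows "x r > 0"
proof (rule ccontr)
  assume "\<not> x r > 0"
  then have xr: "x r = 0" using nonneg[OF \<open>r > 0\<close>] by simp
  have "\<forall>y. \<bar>r - y\<bar> < r \<longrightarrow> x r \<le> x y" using nonneg xr by (auto simp: abs_if split: if_splits)
  then have x'r: "x' r = 0" by (rule DERIV_local_min[OF x[OF \<open>r > 0\<close>] \<open>r > 0\<close>])
  obtain e where e: "e > 0" "\<And>h. 0 < h \<Longrightarrow> h < e \<Longrightarrow> (r + h) * x' (r + h) < r * x' r"
    using DERIV_neg_dec_right[OF flux D[OF xr]] by blast
  have "x (r + e / 2) < x r"
  proof (rule DERIV_neg_imp_decreasing_open[of r "r + e / 2" x])
    show "r < r + e / 2" using e(1) by simp
    show "continuous_on {r..r + e / 2} x"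
      using x \<open>r > 0\<close> by (intro continuous_on_real_derivative[of _ x x']) auto
    fix t assume t: "r < t" "t < r + e / 2"
    then have "t * x' t < 0" using e(2)[of "t - r"] x'r by simp
    then have "x' t < 0" using t \<open>r > 0\<close> by (simp add: mult_less_0_iff)
    then show "\<exists>y. (x has_real_derivative y) (at t) \<and> y < 0" using x[of t] t \<open>r > 0\<close> by auto
  qed
  then show False using xr nonneg[of "r + e / 2"] \<open>r > 0\<close> e(1) by simp
qed

text \<open>The negative parts are bounded by \<open>f'^2 + m'^2\<close>, which is part of the
  energy density.\<close>

lemma (in GL_solution) integrable_Q: "set_integrable lebesgue {0<..} (\<lambda>r. r * Q r)"
  unfolding set_integrable_def
proof (rule integrableI_bounded)
  have "continuous_on {0<..} (\<lambda>r. r * Q r)" by (intro continuous_intros continuous_auxiliary)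
  then have "(\<lambda>r. indicator {0<..} r *\<^sub>R (r * Q r)) \<in> borel_measurable borel"
    by (intro borel_measurable_continuous_on_indicator) simp_all
  then show "(\<lambda>r. indicator {0<..} r *\<^sub>R (r * Q r)) \<in> borel_measurable lebesgue"
    by (simp add: measurable_completion)
  have "(\<integral>\<^sup>+ r. ennreal (norm (indicator {0<..} r *\<^sub>R (r * Q r))) \<partial>lebesgue)
      \<le> (\<integral>\<^sup>+ r\<in>{0<..}. ennreal (energy_density r * r) \<partial>lebesgue)"
  proof (rule nn_integral_mono)
    fix r
    show "ennreal (norm (indicator {0<..} r *\<^sub>R (r * Q r)))
        \<le> ennreal (energy_density r * r) * indicator {0<..} r"
    proof (cases "r > 0")
      case True
      have *: "(min x 0)\<^sup>2 \<le> x\<^sup>2" for x :: real by (simp add: min_def)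
      have "0 \<le> \<kappa>\<^sup>2 * g * (m r)\<^sup>2" using g_pos by simp
      then have "Q r \<le> energy_density r"
        using *[of "p r"] *[of "q r"] unfolding Q_def energy_density_def q_def
        by (simp add: add_increasing add_increasing2 add_mono)
      moreover have "0 \<le> Q r" by (simp add: Q_def)
      ultimately show ?thesis using True
        by (auto intro!: ennreal_leI simp: mult.commute[of r] mult_right_mono)
    qed simp
  qed
  then show "(\<integral>\<^sup>+ r. ennreal (norm (indicator {0<..} r *\<^sub>R (r * Q r))) \<partial>lebesgue) < \<infinity>"
    using energy_finite by (rule le_less_trans)
qed

section \<open>Vanishing of the negative parts and strict monotonicity\<close>

context stable_GL_solution
begin

text \<open>Dominated convergence turns the stability inequalities for the cutoffs into an upper
  bound 0 for the integral of \<open>H\<close>, the limit density with reversed sign.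
  \<open>H\<close> is \<open>Q\<close> times a positive factor, hence nonnegative and continuous,
  and so it must vanish.\<close>

lemma Q_eq_0:
  assumes "r > 0"
  shows "Q r = 0"
proof -
  define G where "G N r = r * (cutoff' N r)\<^sup>2 * Q r - (cutoff N r)\<^sup>2 * Q r / r" for N r
  define H where "H r = (base r)\<^sup>2 * Q r / r - r * (1 / (1 + r)\<^sup>2)\<^sup>2 * Q r" for r
  have Q0: "0 \<le> Q r" for r by (simp add: Q_def)
  have contH: "continuous_on {0<..} H"
    unfolding H_def[abs_def] base_def[abs_def] by (intro continuous_intros continuous_auxiliary) auto
  have contG: "continuous_on {0<..} (G N)" if "N \<ge> 1" for N
    unfolding G_def[abs_def] using cutoff_C1[OF that] continuous_on_real_derivative[of UNIV "cutoff N"]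
    by (intro continuous_intros continuous_auxiliary) (auto intro: continuous_on_subset)
  \<comment> \<open>The factor 10 is 9 from the slope of the cutoff plus 1 from its size.\<close>
  have G_le: "\<bar>G N r\<bar> \<le> 10 * (r * Q r)" if "N \<ge> 1" "r > 0" for N r
  proof -
    note b = cutoff_bounds[OF that]
    have "(cutoff' N r)\<^sup>2 * (r * Q r) \<le> 9 * (r * Q r)"
      using b that Q0 by (intro mult_right_mono) auto
    moreover have "(cutoff N r)\<^sup>2 * (Q r / r) \<le> r\<^sup>2 * (Q r / r)"
      using b that Q0 by (intro mult_right_mono) auto
    moreover have "r\<^sup>2 * (Q r / r) = r * Q r" using that by (simp add: power2_eq_square)
    moreover have "0 \<le> (cutoff' N r)\<^sup>2 * (r * Q r)" "0 \<le> (cutoff N r)\<^sup>2 * (Q r / r)"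
      using that Q0 by auto
    moreover have "G N r = (cutoff' N r)\<^sup>2 * (r * Q r) - (cutoff N r)\<^sup>2 * (Q r / r)"
      by (simp add: G_def)
    ultimately show ?thesis by linarith
  qed
  have G_nonneg: "0 \<le> (LINT r|lebesgue. indicator {0<..} r *\<^sub>R G (real (Suc n)) r)" for n
  proof -
    let ?N = "real (Suc n)"
    have N: "?N \<ge> 1" by simp
    have lo: "0 < 1 / ?N" "1 / ?N \<le> ?N" using N by (auto simp: field_simps)
    have sub: "{1 / ?N..?N} \<subseteq> {0<..}"
      using lo(1) unfolding subset_iff atLeastAtMost_iff greaterThan_iff by (meson less_le_trans)
    have supp: "G ?N r = 0" if "r \<in> {0<..}" "r \<notin> {1 / ?N..?N}" for r
    proof -
      have "r \<notin> {1 / ?N<..<?N}" using that(2) by auto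
      then have "window ?N r = 0" using window_eq_0[OF N] that(1) by simp
      then show ?thesis by (simp add: G_def cutoff_def cutoff'_def)
    qed
    have "0 \<le> integral {1 / ?N..?N} (G ?N)"
      unfolding G_def[abs_def]
      by (rule stability_test[OF cutoff_C1[OF N] cutoff_eq_0[OF N] lo])
    also have "\<dots> = (LINT r:{0<..}|lebesgue. G ?N r)"
      by (rule set_lebesgue_integral_interval_support(2)[OF continuous_on_subset[OF contG[OF N] sub] sub supp, symmetric])
    finally show ?thesis by (simp only: set_lebesgue_integral_def)
  qed
  have meas: "(\<lambda>r. indicator {0<..} r *\<^sub>R F r) \<in> borel_measurable lebesgue"
    if "continuous_on {0<..} F" for F :: "real \<Rightarrow> real"
    using borel_measurable_continuous_on_indicator[OF _ that] by (auto intro!: measurable_completion)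
  have w: "integrable lebesgue (\<lambda>r. 10 * (indicator {0<..} r *\<^sub>R (r * Q r)))"
    using integrable_Q unfolding set_integrable_def by (rule integrable_mult_right)
  have lim: "AE r in lebesgue. (\<lambda>n. indicator {0<..} r *\<^sub>R G (real (Suc n)) r)
      \<longlonglongrightarrow> indicator {0<..} r *\<^sub>R (- H r)"
  proof (rule AE_I2)
    fix r :: real
    show "(\<lambda>n. indicator {0<..} r *\<^sub>R G (real (Suc n)) r) \<longlonglongrightarrow> indicator {0<..} r *\<^sub>R (- H r)"
    proof (cases "r > 0")
      case True
      have "(\<lambda>n. G (real (Suc n)) r) \<longlonglongrightarrow> r * (1 / (1 + r)\<^sup>2)\<^sup>2 * Q r - (base r)\<^sup>2 * Q r / r"
        unfolding G_def using True by (intro tendsto_intros cutoff_tendsto) auto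
      then show ?thesis using True by (simp add: H_def)
    qed simp
  qed
  have bound: "AE r in lebesgue. norm (indicator {0<..} r *\<^sub>R G (real (Suc n)) r)
      \<le> 10 * (indicator {0<..} r *\<^sub>R (r * Q r))" for n
    using G_le[of "real (Suc n)"] by (auto intro!: AE_I2 simp: indicator_def)
  have contH': "continuous_on {0<..} (\<lambda>r. - H r)" using contH by (rule continuous_on_minus)
  note dc = meas[OF contH'] meas[OF contG] w lim bound
  have int: "integrable lebesgue (\<lambda>r. indicator {0<..} r *\<^sub>R (- H r))"
    by (rule integrable_dominated_convergence[OF dc]) simp
  have "(\<lambda>n. LINT r|lebesgue. indicator {0<..} r *\<^sub>R G (real (Suc n)) r)
      \<longlonglongrightarrow> (LINT r|lebesgue. indicator {0<..} r *\<^sub>R (- H r))"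
    by (rule integral_dominated_convergence[OF dc]) simp
  then have "0 \<le> (LINT r|lebesgue. indicator {0<..} r *\<^sub>R (- H r))"
    by (rule LIMSEQ_le_const) (use G_nonneg in blast)
  then have H_int: "(LINT r|lebesgue. indicator {0<..} r *\<^sub>R H r) \<le> 0" by simp
  \<comment> \<open>This is \<open>b^2/r - r b'^2\<close> for \<open>b = r/(1+r)\<close> and
    \<open>b' = 1/(1+r)^2\<close>; its positivity is the strict inequality
    \<open>b' < b/r\<close>.\<close>
  have H_eq: "H r = Q r * (r / (1 + r)\<^sup>2 * (1 - 1 / (1 + r)\<^sup>2))" if "r > 0" for r
  proof -
    define y where "y = (1 + r)\<^sup>2"
    have "(base r)\<^sup>2 * Q r / r = r / y * Q r"
      using that by (simp add: base_def y_def power_divide power2_eq_square[of r])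
    then show ?thesis
      unfolding H_def y_def[symmetric] by (simp add: power2_eq_square[of "1 / y"] algebra_simps diff_divide_distrib)
  qed
  have factor: "0 < r / (1 + r)\<^sup>2 * (1 - 1 / (1 + r)\<^sup>2)" if "r > 0" for r :: real
    using that by (intro mult_pos_pos) (auto simp: divide_less_eq_1 one_less_power)
  have H0: "0 \<le> H r" if "r > 0" for r
    unfolding H_eq[OF that] using factor[OF that] Q0[of r] by (rule mult_nonneg_nonneg[OF _ less_imp_le, rotated])
  \<comment> \<open>An interval starting at the given point: a continuous nonnegative function with
    integral 0 over it vanishes on all of it, also at the endpoint.\<close>
  have sub: "{r..r + 1} \<subseteq> {0<..}" using assms by auto
  have contH1: "continuous_on {r..r + 1} H" using contH sub by (rule continuous_on_subset)
  have intH1: "set_integrable lebesgue {r..r + 1} H"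
    using absolutely_integrable_continuous_real[OF contH1] .
  have "integral {r..r + 1} H = (LINT s:{r..r + 1}|lebesgue. H s)"
    using set_lebesgue_integral_eq_integral(2)[OF intH1] by simp
  also have "\<dots> \<le> (LINT s|lebesgue. indicator {0<..} s *\<^sub>R H s)"
    unfolding set_lebesgue_integral_def
  proof (rule integral_mono)
    show "integrable lebesgue (\<lambda>s. indicator {r..r + 1} s *\<^sub>R H s)"
      using intH1 by (simp only: set_integrable_def)
    show "integrable lebesgue (\<lambda>s. indicator {0<..} s *\<^sub>R H s)"
      using integrable_minus[OF int] by simp
    show "indicator {r..r + 1} s *\<^sub>R H s \<le> indicator {0<..} s *\<^sub>R H s" for s
      using H0[of s] assms by (auto simp: indicator_def)
  qed
  finally have "integral {r..r + 1} H \<le> 0" using H_int by simp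
  moreover have "0 \<le> integral {r..r + 1} H"
    using H0 assms by (intro integral_nonneg integrable_continuous_interval contH1) auto
  ultimately have "integral {r..r + 1} H = 0" by simp
  then have "H r = 0"
    using integral_eq_0_iff[OF contH1] H0 assms by auto
  then show ?thesis using H_eq[OF assms] factor[OF assms] by (metis less_irrefl mult_eq_0_iff)
qed

lemma p_nonneg: "r > 0 \<Longrightarrow> 0 \<le> p r" and q_nonneg: "r > 0 \<Longrightarrow> 0 \<le> q r"
  using Q_eq_0[of r] unfolding Q_def by (auto simp: sum_power2_eq_zero_iff min_def split: if_splits)

lemma p_pos:
  assumes "r > 0"
  shows "0 < p r"
proof (rule positive_if_flux_decreasing[OF p_deriv p_nonneg assms flux_p[OF assms]])
  have "0 \<le> r * B r * q r" using assms B_nonneg[OF assms] q_nonneg[OF assms] by simp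
  moreover have "0 < r * h r" using assms h_pos[OF assms] by simp
  ultimately show "(1 / r + r * A\<^sub>1 r) * p r - (r * B r * q r + r * h r) < 0" if "p r = 0"
    unfolding that by simp
qed

text \<open>The equation for \<open>q\<close> has no source of its own. Strictness comes from the
  coupling \<open>B p\<close>, which is positive once \<open>p > 0\<close> and \<open>m > 0\<close>
  are known; hence \<open>p\<close> is treated before \<open>q\<close>.\<close>

lemma q_pos:
  assumes "r > 0" and "\<exists>r\<ge>0. m r \<noteq> 0"
  shows "0 < q r"
proof (rule positive_if_flux_decreasing[OF q_deriv q_nonneg assms(1) flux_q[OF assms(1)]])
  have "0 < r * B r * p r"
    unfolding B_def using assms(1) \<kappa>_pos f_pos[OF assms(1)] m_pos[OF assms] p_pos[OF assms(1)] by simp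
  then show "(1 / r + r * A\<^sub>2 r) * q r - r * B r * p r < 0" if "q r = 0"
    unfolding that by simp
qed

end

theorem theorem2p9:
  fixes d :: int and g \<kappa> :: real and f S m :: "real \<Rightarrow> real"
  assumes "d \<noteq> 0" and "g > 0" and "\<kappa> > 0"
    and "admissible_solution \<kappa> g d f S m"
    and "\<And>u v w. u \<in> X_space \<Longrightarrow> v \<in> X_space \<Longrightarrow> w \<in> H_space \<Longrightarrow>
           second_variation \<kappa> g d f S m u v w \<ge> 0"
  shows "(\<forall>r>0. deriv f r > 0) \<and> ((\<exists>r\<ge>0. m r \<noteq> 0) \<longrightarrow> (\<forall>r>0. deriv m r < 0))"
proof -
  interpret stable_GL_solution d g \<kappa> f S m
    using assms by unfold_locales
  show ?thesis using p_pos q_pos by (simp add: q_def)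
qed

end
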